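(* Let $G$ be a free non-Abelian group on finitely many generators and let $\ell: G\to\mathbb{N}_0$ be the natural (reduced word) length function on $G$. Let $D$ be the multiplication operator by $\ell$ on $l^2(G)$, let $\mathcal{S}=\mathcal{S}(C^*_r(G))$ be the state space of the reduced group C*-algebra, and for $\varphi,\psi\in\mathcal{S}$ put $$d_\ell(\varphi,\psi)=\sup\{|\varphi(a)-\psi(a)| \; : \; a\in C^*_r(G),\ \|[D,a]\|\le 1\}.$$ Then the metric $d_\ell$ on $\mathcal{S}$ is bounded, and the diameter of $\mathcal{S}$ with respect to $d_\ell$ is at most $5$.
   Context: For a discrete group $G$, $\lambda$ denotes the left regular representation on $l^2(G)$, $(\delta_g)_{g\in G}$ is the natural orthonormal basis of $l^2(G)$, and $C^*_r(G)\subseteq B(l^2(G))$ is the C*-algebra generated by $\{\lambda_g: g\in G\}$. For the free group with a fixed finite set of free generators (at least two), $\ell(g)$ is the length of the reduced word representing $g$ in the generators and their inverses. The operator $D$ is the self-adjoint (unbounded) operator on $l^2(G)$ given by $(D\xi)(g)=\ell(g)\xi(g)$ on its natural domain $\mathrm{dom}(D)=\{\xi\in l^2(G) : \sum_g \ell(g)^2|\xi(g)|^2<\infty\}$; it is the closure of the operator $\delta_g\mapsto \ell(g)\delta_g$ on the linear span of the $\delta_g$. For $a\in B(l^2(G))$, the condition $\|[D,a]\|\le 1$ means that $a(\mathrm{dom}(D))\subseteq\mathrm{dom}(D)$ and that $Da-aD$, defined on $\mathrm{dom}(D)$, is bounded of norm at most $1$. A priori $d_\ell$ takes values in $[0,\infty]$.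 *)

theory Defs
  imports "HOL-Analysis.Analysis"
begin

section \<open>Free groups and word length\<close>

text \<open>
  Groups are written additively, in the class \<^class>\<open>group_add\<close>, which does not assume
  commutativity. A letter \<open>(x, True)\<close> stands for the generator \<open>x\<close>, and \<open>(x, False)\<close> for its
  inverse.
\<close>

definition letter_val :: "'g::group_add \<times> bool \<Rightarrow> 'g" where
  "letter_val = (\<lambda>(x, b). if b then x else - x)"

definition word_val :: "('g::group_add \<times> bool) list \<Rightarrow> 'g" where
  "word_val w = sum_list (map letter_val w)"

definition reduced_words :: "'g set \<Rightarrow> ('g \<times> bool) list set" where
  "reduced_words X =
    {w \<in> lists (X \<times> UNIV). successively (\<lambda>(x, b) (y, c). \<not> (x = y \<and> b \<noteq> c)) w}"

text \<open>
  \<open>X\<close> is a set of free generators of the whole group: every group element is the value of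
  exactly one reduced word over \<open>X\<close>.
\<close>

definition free_generators :: "'g::group_add set \<Rightarrow> bool" where
  "free_generators X \<longleftrightarrow> bij_betw word_val (reduced_words X) UNIV"

definition word_length :: "'g::group_add set \<Rightarrow> 'g \<Rightarrow> nat" where
  "word_length X g = length (THE w. w \<in> reduced_words X \<and> word_val w = g)"


section \<open>The Hilbert space of square-summable functions\<close>

typedef 'g ell2 = "{f :: 'g \<Rightarrow> complex. (\<lambda>x. (cmod (f x))\<^sup>2) summable_on UNIV}"
  morphisms coord Abs_ell2
  by (rule exI[of _ "\<lambda>_. 0"]) simp

setup_lifting type_definition_ell2

lemma ell2_eqI: "(\<And>x. coord \<xi> x = coord \<eta> x) \<Longrightarrow> \<xi> = \<eta>"
  by (metis coord_inject ext)

lemma coord_summable: "(\<lambda>x. (cmod (coord \<xi> x))\<^sup>2) summable_on UNIV"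
  using coord[of \<xi>] by simp

lemma sq_summable_add:
  fixes f g :: "'g \<Rightarrow> complex"
  assumes "(\<lambda>x. (cmod (f x))\<^sup>2) summable_on UNIV" "(\<lambda>x. (cmod (g x))\<^sup>2) summable_on UNIV"
  shows "(\<lambda>x. (cmod (f x + g x))\<^sup>2) summable_on UNIV"
proof (rule summable_on_comparison_test)
  show "(\<lambda>x. 2 * (cmod (f x))\<^sup>2 + 2 * (cmod (g x))\<^sup>2) summable_on UNIV"
    by (intro summable_on_add summable_on_cmult_right assms)
  show "(cmod (f x + g x))\<^sup>2 \<le> 2 * (cmod (f x))\<^sup>2 + 2 * (cmod (g x))\<^sup>2" for x
  proof -
    have "(cmod (f x + g x))\<^sup>2 \<le> (cmod (f x) + cmod (g x))\<^sup>2"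
      by (intro power_mono norm_triangle_ineq) auto
    also have "\<dots> \<le> 2 * (cmod (f x))\<^sup>2 + 2 * (cmod (g x))\<^sup>2"
      using sum_squares_bound[of "cmod (f x)" "cmod (g x)"]
      by (simp add: power2_sum)
    finally show ?thesis .
  qed
qed auto

lemma sq_summable_mult:
  fixes f :: "'g \<Rightarrow> complex"
  assumes "(\<lambda>x. (cmod (f x))\<^sup>2) summable_on UNIV"
  shows "(\<lambda>x. (cmod (c * f x))\<^sup>2) summable_on UNIV"
  using summable_on_cmult_right[OF assms, of "(cmod c)\<^sup>2"]
  by (simp add: norm_mult power_mult_distrib)

lift_definition scaleC :: "complex \<Rightarrow> 'g ell2 \<Rightarrow> 'g ell2" is "\<lambda>c f x. c * f x"
  by (rule sq_summable_mult)

lemma coord_scaleC: "coord (scaleC c \<xi>) x = c * coord \<xi> x"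
  by transfer simp

definition cinner :: "'g ell2 \<Rightarrow> 'g ell2 \<Rightarrow> complex" where
  "cinner \<xi> \<eta> = (\<Sum>\<^sub>\<infinity>x\<in>UNIV. coord \<xi> x * cnj (coord \<eta> x))"

lemma cinner_abs_summable:
  "(\<lambda>x. norm (coord \<xi> x * cnj (coord \<eta> x))) summable_on UNIV"
proof (rule summable_on_comparison_test)
  show "(\<lambda>x. (cmod (coord \<xi> x))\<^sup>2 + (cmod (coord \<eta> x))\<^sup>2) summable_on UNIV"
    by (intro summable_on_add coord_summable)
  show "norm (coord \<xi> x * cnj (coord \<eta> x)) \<le> (cmod (coord \<xi> x))\<^sup>2 + (cmod (coord \<eta> x))\<^sup>2" for x
  proof -
    have "2 * cmod (coord \<xi> x) * cmod (coord \<eta> x) \<le> (cmod (coord \<xi> x))\<^sup>2 + (cmod (coord \<eta> x))\<^sup>2"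
      by (rule sum_squares_bound)
    moreover have "0 \<le> cmod (coord \<xi> x) * cmod (coord \<eta> x)"
      by simp
    ultimately show ?thesis
      unfolding norm_mult complex_mod_cnj by linarith
  qed
qed auto

lemma cinner_summable: "(\<lambda>x. coord \<xi> x * cnj (coord \<eta> x)) summable_on UNIV"
  using cinner_abs_summable by (rule abs_summable_summable)

instantiation ell2 :: (type) "{zero, plus, uminus, minus, scaleR}"
begin

lift_definition zero_ell2 :: "'a ell2" is "\<lambda>_. 0" by simp
lift_definition plus_ell2 :: "'a ell2 \<Rightarrow> 'a ell2 \<Rightarrow> 'a ell2" is "\<lambda>f g x. f x + g x"
  by (rule sq_summable_add)
lift_definition uminus_ell2 :: "'a ell2 \<Rightarrow> 'a ell2" is "\<lambda>f x. - f x" by simp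
definition minus_ell2 :: "'a ell2 \<Rightarrow> 'a ell2 \<Rightarrow> 'a ell2" where "minus_ell2 \<xi> \<eta> = \<xi> + - \<eta>"
definition scaleR_ell2 :: "real \<Rightarrow> 'a ell2 \<Rightarrow> 'a ell2" where
  "scaleR_ell2 r = scaleC (complex_of_real r)"

instance ..

end

lemma coord_zero: "coord 0 x = 0" by transfer simp
lemma coord_plus: "coord (\<xi> + \<eta>) x = coord \<xi> x + coord \<eta> x" by transfer simp
lemma coord_uminus: "coord (- \<xi>) x = - coord \<xi> x" by transfer simp
lemma coord_minus: "coord (\<xi> - \<eta>) x = coord \<xi> x - coord \<eta> x"
  by (simp add: minus_ell2_def coord_plus coord_uminus)
lemma coord_scaleR: "coord (r *\<^sub>R \<xi>) x = complex_of_real r * coord \<xi> x"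
  by (simp add: scaleR_ell2_def coord_scaleC)

lemmas coord_simps = coord_zero coord_plus coord_uminus coord_minus coord_scaleR coord_scaleC

lemma cinner_self: "cinner \<xi> \<xi> = complex_of_real (\<Sum>\<^sub>\<infinity>x\<in>UNIV. (cmod (coord \<xi> x))\<^sup>2)"
proof -
  have "cinner \<xi> \<xi> = (\<Sum>\<^sub>\<infinity>x\<in>UNIV. complex_of_real ((cmod (coord \<xi> x))\<^sup>2))"
    unfolding cinner_def complex_norm_square by simp
  also have "\<dots> = complex_of_real (\<Sum>\<^sub>\<infinity>x\<in>UNIV. (cmod (coord \<xi> x))\<^sup>2)"
    using has_sum_of_real[OF has_sum_infsum[OF coord_summable[of \<xi>]], where 'a = complex]
    by (rule infsumI)
  finally show ?thesis .
qed

text \<open>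
  The real inner product is the real part of \<^const>\<open>cinner\<close>; it induces the usual norm
  (lemma \<open>norm_ell2_eq\<close> below).
\<close>

instantiation ell2 :: (type) real_inner
begin

definition inner_ell2 :: "'a ell2 \<Rightarrow> 'a ell2 \<Rightarrow> real" where "inner_ell2 \<xi> \<eta> = Re (cinner \<xi> \<eta>)"
definition norm_ell2 :: "'a ell2 \<Rightarrow> real" where "norm_ell2 \<xi> = sqrt (inner \<xi> \<xi>)"
definition dist_ell2 :: "'a ell2 \<Rightarrow> 'a ell2 \<Rightarrow> real" where "dist_ell2 \<xi> \<eta> = norm (\<xi> - \<eta>)"
definition sgn_ell2 :: "'a ell2 \<Rightarrow> 'a ell2" where "sgn_ell2 \<xi> = \<xi> /\<^sub>R norm \<xi>"
definition uniformity_ell2 :: "('a ell2 \<times> 'a ell2) filter" where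
  "uniformity_ell2 = (INF e\<in>{0<..}. principal {(\<xi>, \<eta>). dist \<xi> \<eta> < e})"
definition open_ell2 :: "'a ell2 set \<Rightarrow> bool" where
  "open_ell2 U = (\<forall>\<xi>\<in>U. eventually (\<lambda>(\<xi>', \<eta>). \<xi>' = \<xi> \<longrightarrow> \<eta> \<in> U) uniformity)"

instance
proof
  fix \<xi> \<eta> \<zeta> :: "'a ell2" and r s :: real
  show "dist \<xi> \<eta> = norm (\<xi> - \<eta>)" by (rule dist_ell2_def)
  show "uniformity = (INF e\<in>{0<..}. principal {(\<xi>::'a ell2, \<eta>). dist \<xi> \<eta> < e})"
    by (rule uniformity_ell2_def)
  show "open U = (\<forall>\<xi>\<in>U. eventually (\<lambda>(\<xi>', \<eta>). \<xi>' = \<xi> \<longrightarrow> \<eta> \<in> U) uniformity)"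
    for U :: "'a ell2 set" by (rule open_ell2_def)
  show "\<xi> + \<eta> + \<zeta> = \<xi> + (\<eta> + \<zeta>)" "\<xi> + \<eta> = \<eta> + \<xi>" "0 + \<xi> = \<xi>" "- \<xi> + \<xi> = 0" "\<xi> - \<eta> = \<xi> + - \<eta>"
    "r *\<^sub>R (\<xi> + \<eta>) = r *\<^sub>R \<xi> + r *\<^sub>R \<eta>" "(r + s) *\<^sub>R \<xi> = r *\<^sub>R \<xi> + s *\<^sub>R \<xi>"
    "r *\<^sub>R s *\<^sub>R \<xi> = (r * s) *\<^sub>R \<xi>" "1 *\<^sub>R \<xi> = \<xi>"
    by (rule ell2_eqI; simp add: coord_simps algebra_simps)+
  show "sgn \<xi> = \<xi> /\<^sub>R norm \<xi>" by (rule sgn_ell2_def)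
  show "inner \<xi> \<eta> = inner \<eta> \<xi>"
  proof -
    have "cinner \<xi> \<eta> = cnj (cinner \<eta> \<xi>)"
      unfolding cinner_def infsum_cnj[symmetric] by (simp add: mult.commute)
    then show ?thesis by (simp add: inner_ell2_def)
  qed
  show "inner (\<xi> + \<eta>) \<zeta> = inner \<xi> \<zeta> + inner \<eta> \<zeta>"
  proof -
    have "cinner (\<xi> + \<eta>) \<zeta> = cinner \<xi> \<zeta> + cinner \<eta> \<zeta>"
      unfolding cinner_def coord_plus distrib_right
      by (rule infsum_add; rule cinner_summable)
    then show ?thesis by (simp add: inner_ell2_def)
  qed
  show "inner (r *\<^sub>R \<xi>) \<eta> = r * inner \<xi> \<eta>"
  proof -
    have "cinner (r *\<^sub>R \<xi>) \<eta> = complex_of_real r * cinner \<xi> \<eta>"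
      unfolding cinner_def coord_scaleR mult.assoc
      by (rule infsum_cmult_right; rule cinner_summable)
    then show ?thesis by (simp add: inner_ell2_def)
  qed
  show nonneg: "0 \<le> inner \<xi> \<xi>"
    by (simp add: inner_ell2_def cinner_self infsum_nonneg)
  show "(inner \<xi> \<xi> = 0) = (\<xi> = 0)"
  proof
    assume "inner \<xi> \<xi> = 0"
    then have *: "(\<Sum>\<^sub>\<infinity>x\<in>UNIV. (cmod (coord \<xi> x))\<^sup>2) = 0"
      by (simp add: inner_ell2_def cinner_self)
    have "(cmod (coord \<xi> x))\<^sup>2 = 0" for x
      by (rule nonneg_infsum_le_0D[where A = UNIV and f = "\<lambda>x. (cmod (coord \<xi> x))\<^sup>2"])
        (use * coord_summable[of \<xi>] in auto)
    then show "\<xi> = 0" by (intro ell2_eqI) (simp add: coord_zero)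
  next
    assume "\<xi> = 0"
    then show "inner \<xi> \<xi> = 0" by (simp add: inner_ell2_def cinner_def coord_zero)
  qed
  show "norm \<xi> = sqrt (inner \<xi> \<xi>)" by (rule norm_ell2_def)
qed

end

lemma norm_ell2_eq: "norm \<xi> = sqrt (\<Sum>\<^sub>\<infinity>x\<in>UNIV. (cmod (coord \<xi> x))\<^sup>2)"
  by (simp add: norm_ell2_def inner_ell2_def cinner_self)

lemma norm_scaleC: "norm (scaleC c \<xi>) = cmod c * norm \<xi>"
proof -
  have "(\<Sum>\<^sub>\<infinity>x\<in>UNIV. (cmod (coord (scaleC c \<xi>) x))\<^sup>2) =
      (cmod c)\<^sup>2 * (\<Sum>\<^sub>\<infinity>x\<in>UNIV. (cmod (coord \<xi> x))\<^sup>2)"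
    unfolding coord_scaleC norm_mult power_mult_distrib
    by (rule infsum_cmult_right) (rule coord_summable)
  then show ?thesis by (simp add: norm_ell2_eq real_sqrt_mult)
qed

lemma scaleC_add_right: "scaleC c (\<xi> + \<eta>) = scaleC c \<xi> + scaleC c \<eta>"
  by (rule ell2_eqI) (simp add: coord_simps algebra_simps)

lemma scaleC_scaleR: "scaleC c (r *\<^sub>R \<xi>) = r *\<^sub>R scaleC c \<xi>"
  by (rule ell2_eqI) (simp add: coord_simps algebra_simps)


section \<open>Operators and C*-algebras on the Hilbert space\<close>

text \<open>
  The type \<open>'g ell2 \<Rightarrow>\<^sub>L 'g ell2\<close> contains all bounded real-linear maps; its norm is the
  operator norm.
\<close>

type_synonym 'g ell2_op = "'g ell2 \<Rightarrow>\<^sub>L 'g ell2"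

definition bounded_operators :: "'g ell2_op set" where
  "bounded_operators = {T. \<forall>c \<xi>. blinfun_apply T (scaleC c \<xi>) = scaleC c (blinfun_apply T \<xi>)}"

lemma bounded_linear_scaleC: "bounded_linear (scaleC c)"
  by (rule bounded_linear_intro[where K = "cmod c"])
    (simp_all add: scaleC_add_right scaleC_scaleR norm_scaleC mult.commute)

definition scale_op :: "complex \<Rightarrow> 'g ell2_op \<Rightarrow> 'g ell2_op" where
  "scale_op c T = Blinfun (\<lambda>\<xi>. scaleC c (blinfun_apply T \<xi>))"

lemma scale_op_apply: "blinfun_apply (scale_op c T) \<xi> = scaleC c (blinfun_apply T \<xi>)"
  unfolding scale_op_def
  by (subst bounded_linear_Blinfun_apply)
    (auto intro: bounded_linear_compose[OF bounded_linear_scaleC] blinfun.bounded_linear_right)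

definition is_adjoint :: "'g ell2_op \<Rightarrow> 'g ell2_op \<Rightarrow> bool" where
  "is_adjoint b a \<longleftrightarrow>
    (\<forall>\<xi> \<eta>. cinner (blinfun_apply a \<xi>) \<eta> = cinner \<xi> (blinfun_apply b \<eta>))"

definition cstar_subalgebra :: "'g ell2_op set \<Rightarrow> bool" where
  "cstar_subalgebra A \<longleftrightarrow>
    A \<subseteq> bounded_operators \<and> closed A \<and> 0 \<in> A \<and>
    (\<forall>a\<in>A. \<forall>b\<in>A. a + b \<in> A \<and> a o\<^sub>L b \<in> A) \<and>
    (\<forall>a\<in>A. \<forall>c. scale_op c a \<in> A) \<and>
    (\<forall>a\<in>A. \<exists>b\<in>A. is_adjoint b a)"

definition cstar_generated :: "'g ell2_op set \<Rightarrow> 'g ell2_op set" where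
  "cstar_generated M = \<Inter> {A. cstar_subalgebra A \<and> M \<subseteq> A}"

text \<open>The left regular representation: \<open>\<lambda>\<^sub>g \<delta>\<^sub>h = \<delta>\<^bsub>g + h\<^esub>\<close>.\<close>

lemma left_translate_has_sum:
  fixes f :: "'g::group_add \<Rightarrow> real"
  shows "((\<lambda>x. f (- g + x)) has_sum s) UNIV \<longleftrightarrow> (f has_sum s) UNIV"
  by (rule has_sum_reindex_bij_witness[where i = "\<lambda>x. g + x" and j = "\<lambda>x. - g + x"])
    (auto simp: add.assoc[symmetric])

lift_definition translate :: "'g::group_add \<Rightarrow> 'g ell2 \<Rightarrow> 'g ell2" is "\<lambda>g f x. f (- g + x)"
  by (simp add: summable_on_def left_translate_has_sum[where f = "\<lambda>x. (cmod (_ x))\<^sup>2"])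

lemma coord_translate: "coord (translate g \<xi>) x = coord \<xi> (- g + x)"
  by transfer simp

lemma norm_translate: "norm (translate g \<xi>) = norm \<xi>"
proof -
  have "(\<Sum>\<^sub>\<infinity>x\<in>UNIV. (cmod (coord \<xi> (- g + x)))\<^sup>2) = (\<Sum>\<^sub>\<infinity>x\<in>UNIV. (cmod (coord \<xi> x))\<^sup>2)"
    by (rule infsumI, subst left_translate_has_sum[where f = "\<lambda>x. (cmod (coord \<xi> x))\<^sup>2"])
      (rule has_sum_infsum[OF coord_summable])
  then show ?thesis by (simp add: norm_ell2_eq coord_translate)
qed

definition left_regular :: "'g::group_add \<Rightarrow> 'g ell2_op" where
  "left_regular g = Blinfun (translate g)"

lemma left_regular_apply: "blinfun_apply (left_regular g) \<xi> = translate g \<xi>"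
proof -
  have "bounded_linear (translate g)"
    by (rule bounded_linear_intro[where K = 1])
      (auto intro!: ell2_eqI simp: coord_simps coord_translate norm_translate)
  then show ?thesis by (simp add: left_regular_def bounded_linear_Blinfun_apply)
qed

definition reduced_group_cstar :: "'g::group_add ell2_op set" where
  "reduced_group_cstar = cstar_generated (range left_regular)"


section \<open>States\<close>

text \<open>
  States are positive linear functionals of norm one. A functional on \<open>A\<close> is a function that is
  \<^const>\<open>undefined\<close> off \<open>A\<close>; the positive elements of \<open>A\<close> are those of the form \<open>b a\<close> with \<open>b\<close>
  the adjoint of \<open>a \<in> A\<close>.
\<close>

definition states :: "'g ell2_op set \<Rightarrow> ('g ell2_op \<Rightarrow> complex) set" where
  "states A = {\<phi> \<in> extensional A.
    (\<forall>a\<in>A. \<forall>b\<in>A. \<phi> (a + b) = \<phi> a + \<phi> b) \<and>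
    (\<forall>a\<in>A. \<forall>c. \<phi> (scale_op c a) = c * \<phi> a) \<and>
    (\<forall>a\<in>A. \<forall>b\<in>A. is_adjoint b a \<longrightarrow> \<phi> (b o\<^sub>L a) \<in> \<real>\<^sub>\<ge>\<^sub>0) \<and>
    (SUP a\<in>{a\<in>A. norm a \<le> 1}. ennreal (cmod (\<phi> a))) = 1}"


section \<open>The length operator and the associated metric\<close>

definition dom_D :: "('g \<Rightarrow> nat) \<Rightarrow> 'g ell2 set" where
  "dom_D l = {\<xi>. (\<lambda>g. (real (l g))\<^sup>2 * (cmod (coord \<xi> g))\<^sup>2) summable_on UNIV}"

text \<open>Only meaningful on \<^const>\<open>dom_D\<close>, where the product is again square-summable.\<close>

definition op_D :: "('g \<Rightarrow> nat) \<Rightarrow> 'g ell2 \<Rightarrow> 'g ell2" where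
  "op_D l \<xi> = Abs_ell2 (\<lambda>g. of_nat (l g) * coord \<xi> g)"

lemma coord_op_D:
  assumes "\<xi> \<in> dom_D l"
  shows "coord (op_D l \<xi>) g = of_nat (l g) * coord \<xi> g"
  using assms unfolding op_D_def dom_D_def
  by (subst Abs_ell2_inverse) (simp_all add: norm_mult power_mult_distrib)

definition commutator_norm_le :: "('g \<Rightarrow> nat) \<Rightarrow> 'g ell2_op \<Rightarrow> real \<Rightarrow> bool" where
  "commutator_norm_le l a K \<longleftrightarrow>
    blinfun_apply a ` dom_D l \<subseteq> dom_D l \<and>
    (\<forall>\<xi>\<in>dom_D l. norm (op_D l (blinfun_apply a \<xi>) - blinfun_apply a (op_D l \<xi>)) \<le> K * norm \<xi>)"

definition d_length ::
  "('g::group_add \<Rightarrow> nat) \<Rightarrow> ('g ell2_op \<Rightarrow> complex) \<Rightarrow> ('g ell2_op \<Rightarrow> complex) \<Rightarrow> ennreal" where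
  "d_length l \<phi> \<psi> =
    (SUP a\<in>{a \<in> reduced_group_cstar. commutator_norm_le l a 1}. ennreal (cmod (\<phi> a - \<psi> a)))"

end

theory Submission
  imports Defs
begin

text \<open>
  Let \<open>a\<close> have matrix entries \<open>\<alpha>(g h\<^sup>-\<^sup>1)\<close> with \<open>\<alpha>(1) = 0\<close> (subtract a multiple of the identity, on
  which states agree) and \<open>\<parallel>[D, a]\<parallel> \<le> 1\<close>; it suffices that \<open>\<parallel>a\<parallel> \<le> 5/2\<close>. Cut \<open>a\<close> into blocks
  between the spheres of the group. The off-diagonal part is \<open>a\<close> minus the average of
  \<open>e\<^bsup>itD\<^esup> a e\<^bsup>-itD\<^esup>\<close> over \<open>t \<in> [-\<pi>, \<pi>]\<close>, and each \<open>a - e\<^bsup>itD\<^esup> a e\<^bsup>-itD\<^esup>\<close> has norm at most \<open>\<bar>t\<bar>\<close>, so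
  this part has norm at most \<open>\<pi>/2\<close>. On a single sphere only words of even length \<open>2j\<close> contribute,
  and by Haagerup's argument the contribution of length \<open>2j\<close> has norm at most the \<open>l\<^sup>2\<close>-norm
  \<open>\<parallel>\<alpha>\<^sub>2\<^sub>j\<parallel>\<close> of the corresponding coefficients. Applying \<open>[D, a]\<close> to \<open>\<delta>\<^sub>1\<close> gives
  \<open>\<Sum>\<^sub>j (2j)\<^sup>2 \<parallel>\<alpha>\<^sub>2\<^sub>j\<parallel>\<^sup>2 \<le> 1\<close>, hence the diagonal part has norm at most
  \<open>(\<Sum>\<^sub>j 1/(2j)\<^sup>2)\<^bsup>1/2\<^esup> \<le> 2\<^bsup>-1/2\<^esup>\<close>, and \<open>\<pi>/2 + 2\<^bsup>-1/2\<^esup> < 5/2\<close>.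
\<close>

section \<open>Reduced words\<close>

definition inverse_word :: "('g \<times> bool) list \<Rightarrow> ('g \<times> bool) list" where
  "inverse_word w = rev (map (\<lambda>(x, b). (x, \<not> b)) w)"

abbreviation noncancelling :: "'g \<times> bool \<Rightarrow> 'g \<times> bool \<Rightarrow> bool" where
  "noncancelling \<equiv> \<lambda>(x, b) (y, c). \<not> (x = y \<and> b \<noteq> c)"

lemma word_val_Nil [simp]: "word_val [] = 0"
  by (simp add: word_val_def)

lemma word_val_Cons [simp]: "word_val (s # w) = letter_val s + word_val w"
  by (simp add: word_val_def)

lemma word_val_append [simp]: "word_val (v @ w) = word_val v + word_val w"
  by (simp add: word_val_def)

lemma word_val_inverse_word: "word_val (inverse_word w) = - word_val w"
proof (induction w)
  case (Cons s w)
  have "letter_val (case s of (x, b) \<Rightarrow> (x, \<not> b)) = - letter_val s"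
    by (auto simp: letter_val_def split: prod.splits)
  with Cons show ?case
    by (simp add: inverse_word_def minus_add)
qed (simp add: inverse_word_def)

lemma length_inverse_word [simp]: "length (inverse_word w) = length w"
  by (simp add: inverse_word_def)

lemma reduced_words_inverse_word:
  assumes "w \<in> reduced_words X"
  shows "inverse_word w \<in> reduced_words X"
proof -
  have "successively noncancelling w" and "w \<in> lists (X \<times> UNIV)"
    using assms by (auto simp: reduced_words_def)
  \<comment> \<open>Noncancellation is symmetric in its two letters and invariant under flipping
    both signs; this handles the reversal and the inversion of letters.\<close>
  moreover have "successively noncancelling (inverse_word w) \<longleftrightarrow> successively noncancelling w"
    unfolding inverse_word_def successively_rev successively_map
    by (rule successively_cong) auto
  ultimately show ?thesis
    by (auto simp: reduced_words_def inverse_word_def lists_eq_set)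
qed

lemma reduced_words_appendD:
  assumes "u @ v \<in> reduced_words X"
  shows "u \<in> reduced_words X" "v \<in> reduced_words X"
  using assms by (auto simp: reduced_words_def successively_append_iff)

context
  fixes X :: "'g::group_add set"
  assumes free: "free_generators X"
begin

definition reduced_word :: "'g \<Rightarrow> ('g \<times> bool) list" where
  "reduced_word g = (THE w. w \<in> reduced_words X \<and> word_val w = g)"

lemma ex1_reduced_word: "\<exists>!w. w \<in> reduced_words X \<and> word_val w = g"
  using free unfolding free_generators_def bij_betw_def inj_on_def by (metis UNIV_I imageE)

lemma reduced_word: "reduced_word g \<in> reduced_words X" "word_val (reduced_word g) = g"
  using theI'[OF ex1_reduced_word[of g]] by (auto simp: reduced_word_def)

lemma reduced_word_eqI: "w \<in> reduced_words X \<Longrightarrow> word_val w = g \<Longrightarrow> reduced_word g = w"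
  using ex1_reduced_word[of g] reduced_word[of g] by blast

lemma word_length_eq: "word_length X g = length (reduced_word g)"
  by (simp add: word_length_def reduced_word_def)

lemma reduced_word_inject: "reduced_word g = reduced_word h \<longleftrightarrow> g = h"
  by (metis reduced_word(2))

section \<open>Word length: subadditivity and symmetry\<close>

lemma word_length_0 [simp]: "word_length X 0 = 0"
proof -
  have "reduced_word 0 = []"
    by (rule reduced_word_eqI) (auto simp: reduced_words_def)
  then show ?thesis by (simp add: word_length_eq)
qed

text \<open>Either the new letter can be put in front of the reduced word, or it cancels the first
  letter and leaves a shorter reduced word.\<close>

lemma word_length_letter_add:
  assumes "s \<in> X \<times> UNIV"
  shows "word_length X (letter_val s + g) \<le> Suc (word_length X g)"
proof (cases "s # reduced_word g \<in> reduced_words X")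
  case True
  then have "reduced_word (letter_val s + g) = s # reduced_word g"
    by (rule reduced_word_eqI) (simp add: reduced_word)
  then show ?thesis by (simp add: word_length_eq)
next
  case False
  then obtain t w where w: "reduced_word g = t # w" "\<not> noncancelling s t"
    using assms reduced_word(1)[of g]
    by (cases "reduced_word g") (auto simp: reduced_words_def)
  have "letter_val s = - letter_val t"
    using w(2) by (auto simp: letter_val_def split: prod.splits)
  moreover have "g = letter_val t + word_val w"
    using reduced_word(2)[of g] w by simp
  ultimately have "letter_val s + g = word_val w"
    by (simp add: add.assoc[symmetric])
  moreover have "w \<in> reduced_words X"
    using reduced_words_appendD(2)[of "[t]" w] reduced_word(1)[of g] w by simp
  ultimately have "reduced_word (letter_val s + g) = w"
    by (intro reduced_word_eqI) auto
  then show ?thesis using w by (simp add: word_length_eq)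
qed

lemma word_length_word_val_add:
  assumes "w \<in> lists (X \<times> UNIV)"
  shows "word_length X (word_val w + g) \<le> length w + word_length X g"
  using assms
proof (induction w)
  case (Cons s w)
  then have "word_length X (letter_val s + (word_val w + g)) \<le> Suc (word_length X (word_val w + g))"
    by (intro word_length_letter_add)
  with Cons show ?case by (simp add: add.assoc)
qed simp

lemma word_length_triangle: "word_length X (g + h) \<le> word_length X g + word_length X h"
  using word_length_word_val_add[of "reduced_word g" h] reduced_word[of g]
  by (simp add: word_length_eq reduced_words_def)

lemma word_length_minus [simp]: "word_length X (- g) = word_length X g"
proof -
  have "reduced_word (- g) = inverse_word (reduced_word g)"
    by (rule reduced_word_eqI)
      (simp_all add: reduced_words_inverse_word word_val_inverse_word reduced_word)
  then show ?thesis by (simp add: word_length_eq)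
qed

text \<open>The reverse triangle inequality, with \<open>h = - g + (g + h)\<close> for the other
  direction. It makes the commutator of the length operator with a translation bounded.\<close>

lemma word_length_add_diff:
  "\<bar>real (word_length X (g + h)) - real (word_length X h)\<bar> \<le> real (word_length X g)"
  using word_length_triangle[of g h] word_length_triangle[of "- g" "g + h"]
  by (simp add: add.assoc[symmetric])

text \<open>Write \<open>g = u z\<close> and \<open>h = v z\<close> with \<open>z\<close> the longest common suffix; then \<open>u v\<^sup>-\<^sup>1\<close> is reduced.\<close>

lemma word_length_diff_sphere:
  assumes "g \<noteq> h" "word_length X g = word_length X h"
  obtains j where "j \<ge> 1" "word_length X (g - h) = 2 * j"
    "take j (reduced_word g) = take j (reduced_word (g - h))"
    "drop j (reduced_word g) = drop j (reduced_word h)"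
proof -
  obtain z u v where g: "reduced_word g = u @ z" and h: "reduced_word h = v @ z"
    and suf: "u = [] \<or> v = [] \<or> last u \<noteq> last v"
  proof -
    \<comment> \<open>A longest common suffix is a longest common prefix of the reversed
      words.\<close>
    obtain z u v where "rev (reduced_word g) = z @ u" "rev (reduced_word h) = z @ v"
      "u = [] \<or> v = [] \<or> hd u \<noteq> hd v"
      by (metis longest_common_prefix list.sel(1) neq_Nil_conv)
    then show ?thesis
      by (intro that[of "rev u" "rev z" "rev v"])
        (auto simp: last_rev rev_swap)
  qed
  have len: "length u = length v"
    using assms(2) g h by (simp add: word_length_eq)
  have ne: "u \<noteq> []" "v \<noteq> []"
    using assms(1) g h len reduced_word_inject[of g h] by auto
  have red: "u \<in> reduced_words X" "v \<in> reduced_words X"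
    using reduced_word(1) g h reduced_words_appendD(1) by metis+
  \<comment> \<open>The first letter of \<open>inverse_word v\<close> is the inverse of
    \<open>last v\<close>, so it could cancel \<open>last u\<close> only if the two last letters
    agreed, against the maximality of \<open>z\<close>.\<close>
  have "noncancelling (last u) (hd (inverse_word v))"
    using suf ne by (auto simp: inverse_word_def hd_rev last_map split: prod.splits)
  then have "u @ inverse_word v \<in> reduced_words X"
    using red(1) reduced_words_inverse_word[OF red(2)]
    by (auto simp: reduced_words_def successively_append_iff)
  moreover have "word_val (u @ inverse_word v) = g - h"
  proof -
    have "g = word_val u + word_val z" "h = word_val v + word_val z"
      using reduced_word(2)[of g] reduced_word(2)[of h] g h by auto
    then show ?thesis
      by (simp add: word_val_inverse_word diff_conv_add_uminus minus_add add.assoc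
          del: add_uminus_conv_diff)
  qed
  ultimately have *: "reduced_word (g - h) = u @ inverse_word v"
    by (rule reduced_word_eqI)
  \<comment> \<open>On a common sphere \<open>u\<close> and \<open>v\<close> have equal length
    \<open>j\<close>, so the reduced word of \<open>g - h\<close> has length \<open>2 * j\<close>
    and begins with \<open>u\<close>.\<close>
  show ?thesis
    by (rule that[of "length u"]) (use ne g h len * in \<open>auto simp: word_length_eq Suc_le_eq\<close>)
qed

end

section \<open>A Bohr inequality for trigonometric polynomials\<close>

lemma arctan_le_self:
  assumes "0 \<le> x"
  shows "arctan x \<le> x"
proof -
  have "0 - arctan 0 \<le> x - arctan x"
  proof (rule DERIV_nonneg_imp_nondecreasing[OF assms])
    fix y :: real
    have "((\<lambda>y. y - arctan y) has_real_derivative (1 - inverse (1 + y\<^sup>2))) (at y)"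
      by (auto intro!: derivative_eq_intros)
    moreover have "inverse (1 + y\<^sup>2) \<le> 1"
      by (simp add: inverse_le_1_iff)
    ultimately show "\<exists>D. ((\<lambda>y. y - arctan y) has_real_derivative D) (at y) \<and> 0 \<le> D"
      by force
  qed
  then show ?thesis by simp
qed

text \<open>Machin's formula pi = 16 arctan(1/5) - 4 arctan(1/239), with the second term dropped.
  Half of 16/5 plus 9/10 is exactly the 5/2 required later.\<close>

lemma pi_le_16_5: "pi \<le> 16 / 5"
proof -
  have "0 < arctan (1 / 239)" by simp
  then show ?thesis using machin arctan_le_self[of "1 / 5"] by linarith
qed

section \<open>Exponential sums over symmetric intervals\<close>

lemma sum_abs_symmetric_interval: "(\<Sum>j\<in>{- int M..int M}. \<bar>real_of_int j\<bar>) = real (M * (M + 1))"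
proof (induction M)
  case (Suc M)
  have "{- int (Suc M)..int (Suc M)} = insert (- int (Suc M)) (insert (int (Suc M)) {- int M..int M})"
    by auto
  with Suc show ?case by (simp add: algebra_simps)
qed simp

text \<open>The geometric sum with its denominator multiplied out, so that
  \<open>cis \<theta> = 1\<close> needs no separate case.\<close>

lemma sum_cis_symmetric_interval:
  "(cis \<theta> - 1) * (\<Sum>j\<in>{- int M..int M}. cis (real_of_int j * \<theta>)) =
    cis (real (M + 1) * \<theta>) - cis (- (real M * \<theta>))"
proof (induction M)
  case (Suc M)
  have *: "{- int (Suc M)..int (Suc M)} =
      insert (- int (Suc M)) (insert (int (Suc M)) {- int M..int M})"
    by auto
  show ?case
    unfolding * using Suc by (simp add: algebra_simps cis_mult)
qed (simp add: cis_mult algebra_simps)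

text \<open>The step angle times 2M + 1 is a multiple of a full turn, so the two boundary terms of
  the geometric sum coincide.\<close>

lemma sum_cis_roots_of_unity:
  assumes "\<bar>d\<bar> \<le> int M" "d \<noteq> 0"
  shows "(\<Sum>j\<in>{- int M..int M}. cis (2 * pi * real_of_int j / (2 * real M + 1) * real_of_int d)) = 0"
proof -
  define \<theta> where "\<theta> = 2 * pi * real_of_int d / (2 * real M + 1)"
  have "real (M + 1) * \<theta> = - (real M * \<theta>) + 2 * pi * real_of_int d"
    by (simp add: \<theta>_def field_simps)
  then have "cis (real (M + 1) * \<theta>) = cis (- (real M * \<theta>))"
    by (metis cis_mult cis_multiple_2pi Ints_of_int mult.right_neutral)
  \<comment> \<open>Otherwise 2M + 1 would divide \<open>d\<close>, although 0 < |d| <= M.\<close>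
  moreover have "cis \<theta> \<noteq> 1"
  proof
    assume "cis \<theta> = 1"
    then obtain n :: int where "\<theta> = of_int (2 * n) * pi"
      by (auto simp: cis_conv_exp exp_eq_1)
    then have "pi * (2 * real_of_int d) = pi * (2 * (real_of_int n * (2 * real M + 1)))"
      by (simp add: \<theta>_def field_simps)
    then have "real_of_int d = real_of_int (n * (2 * int M + 1))"
      by simp
    then have "d = n * (2 * int M + 1)"
      by linarith
    then have "\<bar>d\<bar> = \<bar>n\<bar> * (2 * int M + 1)" "n \<noteq> 0"
      using assms(2) by (auto simp: abs_mult)
    moreover from \<open>n \<noteq> 0\<close> have "1 * (2 * int M + 1) \<le> \<bar>n\<bar> * (2 * int M + 1)"
      by (intro mult_right_mono) auto
    ultimately have "2 * int M + 1 \<le> \<bar>d\<bar>"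
      by (simp only: mult_1)
    then show False
      using assms(1) by linarith
  qed
  ultimately have "(\<Sum>j\<in>{- int M..int M}. cis (real_of_int j * \<theta>)) = 0"
    using sum_cis_symmetric_interval[of \<theta> M] by simp
  moreover have "real_of_int j * \<theta> = 2 * pi * real_of_int j / (2 * real M + 1) * real_of_int d" for j
    by (simp add: \<theta>_def)
  ultimately show ?thesis by simp
qed

text \<open>The mean value inequality: up to the factor \<open>\<i>\<close>, the sum bounded by
  \<open>K\<close> is the derivative of the polynomial at \<open>t\<close>.\<close>

lemma trig_poly_lipschitz:
  fixes c :: "'b \<Rightarrow> complex" and d :: "'b \<Rightarrow> int"
  assumes "\<And>t. cmod (\<Sum>p\<in>P. of_int (d p) * c p * cis (t * real_of_int (d p))) \<le> K"
  shows "cmod ((\<Sum>p\<in>P. c p) - (\<Sum>p\<in>P. c p * cis (t * real_of_int (d p)))) \<le> K * \<bar>t\<bar>"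
proof -
  define \<Phi> where "\<Phi> t = (\<Sum>p\<in>P. c p * cis (t * real_of_int (d p)))" for t
  define \<Phi>' where "\<Phi>' t = (\<Sum>p\<in>P. of_int (d p) * c p * cis (t * real_of_int (d p)))" for t
  have deriv: "(\<Phi> has_derivative (\<lambda>s. s *\<^sub>R (\<i> * \<Phi>' t))) (at t within UNIV)" for t
    unfolding \<Phi>_def \<Phi>'_def
    by (auto intro!: derivative_eq_intros
        simp: sum_distrib_left scaleR_conv_of_real algebra_simps)
  have "onorm (\<lambda>s. s *\<^sub>R (\<i> * \<Phi>' t)) \<le> K" for t
    using assms[of t] unfolding \<Phi>'_def[symmetric]
    by (intro onorm_le) (simp add: norm_mult mult.commute[of K] mult_left_mono)
  then have "norm (\<Phi> 0 - \<Phi> t) \<le> K * norm (0 - t)"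
    by (intro differentiable_bound[OF convex_UNIV deriv]) auto
  then show ?thesis by (simp add: \<Phi>_def)
qed

text \<open>
  Averaging the translates of a trigonometric polynomial over the roots of unity of a large odd
  order leaves only its constant term, and the average of \<open>\<bar>t\<bar>\<close> over \<open>[-\<pi>, \<pi>]\<close> is \<open>\<pi>/2\<close>.
\<close>

lemma trig_poly_bohr:
  fixes c :: "'b \<Rightarrow> complex" and d :: "'b \<Rightarrow> int"
  assumes "finite P"
    and bound: "\<And>t. cmod (\<Sum>p\<in>P. of_int (d p) * c p * cis (t * real_of_int (d p))) \<le> K"
  shows "cmod (\<Sum>p | p \<in> P \<and> d p \<noteq> 0. c p) \<le> pi / 2 * K"
proof -
  \<comment> \<open>\<open>M\<close> dominates every frequency, so a nonzero frequency is never
    divisible by N = 2M + 1 and the averaging kills it.\<close>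
  obtain M :: nat where M: "\<bar>d p\<bar> \<le> int M" if "p \<in> P" for p
  proof -
    have "\<bar>d p\<bar> \<le> int (\<Sum>p\<in>P. nat \<bar>d p\<bar>)" if "p \<in> P" for p
      using member_le_sum[OF that, of "\<lambda>p. nat \<bar>d p\<bar>"] assms(1) by linarith
    then show ?thesis using that by blast
  qed
  define N where "N = 2 * real M + 1"
  define J where "J = {- int M..int M}"
  define \<tau> where "\<tau> j = 2 * pi * real_of_int j / N" for j
  define \<Phi> where "\<Phi> t = (\<Sum>p\<in>P. c p * cis (t * real_of_int (d p)))" for t
  have N: "N > 0" by (simp add: N_def add_nonneg_pos)
  have K: "K \<ge> 0" using bound[of 0] norm_ge_zero order.trans by blast
  have "(\<Sum>j\<in>J. \<Phi> (\<tau> j)) = (\<Sum>p\<in>P. c p * (\<Sum>j\<in>J. cis (\<tau> j * real_of_int (d p))))"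
    unfolding \<Phi>_def sum_distrib_left by (rule sum.swap)
  also have "\<dots> = (\<Sum>p\<in>P. if d p = 0 then of_real N * c p else 0)"
  proof (rule sum.cong[OF refl])
    fix p assume "p \<in> P"
    show "c p * (\<Sum>j\<in>J. cis (\<tau> j * real_of_int (d p))) = (if d p = 0 then of_real N * c p else 0)"
      using sum_cis_roots_of_unity[of "d p" M] M[OF \<open>p \<in> P\<close>]
      by (auto simp: J_def \<tau>_def N_def)
  qed
  also have "\<dots> = of_real N * (\<Sum>p | p \<in> P \<and> d p = 0. c p)"
    using assms(1) by (simp add: sum.If_cases sum_distrib_left Int_def)
  finally have avg: "(\<Sum>j\<in>J. \<Phi> (\<tau> j)) = of_real N * (\<Sum>p | p \<in> P \<and> d p = 0. c p)" .
  have split: "(\<Sum>p\<in>P. c p) = (\<Sum>p | p \<in> P \<and> d p \<noteq> 0. c p) + (\<Sum>p | p \<in> P \<and> d p = 0. c p)"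
  proof -
    have "P = {p \<in> P. d p \<noteq> 0} \<union> {p \<in> P. d p = 0}" by auto
    then show ?thesis
      using assms(1) by (subst sum.union_disjoint[symmetric]) auto
  qed
  have card: "of_nat (card J) = complex_of_real N"
    by (simp add: J_def N_def)
  \<comment> \<open>Here the sum of all \<open>c p\<close> is the value of \<open>\<Phi>\<close> at
    0, and subtracting the average of \<open>\<Phi>\<close> removes exactly the terms of frequency
    0.\<close>
  have "of_real N * (\<Sum>p | p \<in> P \<and> d p \<noteq> 0. c p) = (\<Sum>j\<in>J. (\<Sum>p\<in>P. c p) - \<Phi> (\<tau> j))"
    unfolding sum_subtractf avg sum_constant card split by (simp add: distrib_left)
  then have "N * cmod (\<Sum>p | p \<in> P \<and> d p \<noteq> 0. c p) = cmod (\<Sum>j\<in>J. (\<Sum>p\<in>P. c p) - \<Phi> (\<tau> j))"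
    using N by (metis abs_of_pos norm_mult norm_of_real)
  also have "\<dots> \<le> (\<Sum>j\<in>J. K * \<bar>\<tau> j\<bar>)"
    unfolding \<Phi>_def by (rule sum_norm_le) (rule trig_poly_lipschitz[OF bound])
  also have "\<dots> = K * (2 * pi / N) * (\<Sum>j\<in>J. \<bar>real_of_int j\<bar>)"
    using N by (simp add: \<tau>_def abs_mult sum_distrib_left sum_divide_distrib mult_ac)
  also have "\<dots> = K * (2 * pi / N) * (real M * (real M + 1))"
    by (simp add: J_def sum_abs_symmetric_interval algebra_simps)
  \<comment> \<open>M (M + 1) = (N^2 - 1) / 4.\<close>
  also have "\<dots> \<le> K * (2 * pi / N) * (N * N / 4)"
    using N K by (intro mult_left_mono) (auto simp: N_def field_simps)
  also have "\<dots> = N * (pi / 2 * K)"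
    using N by (simp add: field_simps)
  finally show ?thesis using N by simp
qed

section \<open>Partial convolutions\<close>

lemma L2_set_fibres:
  assumes "finite F"
  shows "L2_set (\<lambda>\<zeta>. L2_set f {g \<in> F. z g = \<zeta>}) (z ` F) = L2_set f F"
  using sum.image_gen[OF assms, of "\<lambda>g. (f g)\<^sup>2" z] by (simp add: L2_set_def sum_nonneg)

lemma L2_set_subset:
  assumes "finite B" "A \<subseteq> B"
  shows "L2_set f A \<le> L2_set f B"
  unfolding L2_set_def using assms by (intro real_sqrt_le_mono sum_mono2) auto

lemma L2_set_product:
  "L2_set (\<lambda>(g, h). f g * f' h) (A \<times> B) = L2_set f A * L2_set f' B"
  unfolding L2_set_def real_sqrt_mult[symmetric] sum_product sum.cartesian_product
  by (simp add: case_prod_unfold power_mult_distrib)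

lemma L2_set_reindex:
  assumes "inj_on \<pi> A"
  shows "L2_set f (\<pi> ` A) = L2_set (f \<circ> \<pi>) A"
  using sum.reindex[OF assms, of "\<lambda>x. (f x)\<^sup>2"] by (simp add: L2_set_def o_def)

text \<open>Haagerup's argument in abstract form. The label \<open>z\<close> cuts the matrix into
  blocks, since both indices of a pair in \<open>P\<close> carry the same label. Inside a block
  every value of \<open>\<delta>\<close> occurs at most once, so its Hilbert-Schmidt norm is at most
  the l2 norm of \<open>\<alpha>\<close> on \<open>D\<close>. Blocks with different labels involve
  disjoint coordinates, so the same constant bounds the whole matrix.\<close>

lemma partial_convolution_bound:
  fixes \<alpha> :: "'d \<Rightarrow> complex" and \<delta> :: "'a \<Rightarrow> 'a \<Rightarrow> 'd"
  assumes F: "finite F" and P: "P \<subseteq> F \<times> F" "\<And>g h. (g, h) \<in> P \<Longrightarrow> z g = z h"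
    and inj: "inj_on (\<lambda>(g, h). (z g, \<delta> g h)) P"
    and D: "finite D" "\<And>g h. (g, h) \<in> P \<Longrightarrow> \<delta> g h \<in> D"
  shows "cmod (\<Sum>(g, h)\<in>P. \<alpha> (\<delta> g h) * x h * cnj (y g)) \<le>
    L2_set (\<lambda>d. cmod (\<alpha> d)) D * (L2_set (\<lambda>h. cmod (x h)) F * L2_set (\<lambda>g. cmod (y g)) F)"
proof -
  define a where "a = L2_set (\<lambda>d. cmod (\<alpha> d)) D"
  define G where "G \<zeta> = {g \<in> F. z g = \<zeta>}" for \<zeta>
  define Q where "Q \<zeta> = {p \<in> P. z (fst p) = \<zeta>}" for \<zeta>
  have finP: "finite P" using P(1) F finite_subset by blast
  have Q: "(\<Sum>(g, h)\<in>Q \<zeta>. cmod (\<alpha> (\<delta> g h)) * (cmod (y g) * cmod (x h))) \<le>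
      a * (L2_set (\<lambda>h. cmod (x h)) (G \<zeta>) * L2_set (\<lambda>g. cmod (y g)) (G \<zeta>))" for \<zeta>
  proof -
    have "(\<Sum>(g, h)\<in>Q \<zeta>. cmod (\<alpha> (\<delta> g h)) * (cmod (y g) * cmod (x h))) \<le>
        L2_set (\<lambda>(g, h). cmod (\<alpha> (\<delta> g h))) (Q \<zeta>) * L2_set (\<lambda>(g, h). cmod (y g) * cmod (x h)) (Q \<zeta>)"
      using L2_set_mult_ineq[of "\<lambda>(g, h). cmod (\<alpha> (\<delta> g h))" "\<lambda>(g, h). cmod (y g) * cmod (x h)" "Q \<zeta>"]
      by (simp add: case_prod_unfold abs_mult)
    also have "\<dots> \<le> a * (L2_set (\<lambda>g. cmod (y g)) (G \<zeta>) * L2_set (\<lambda>h. cmod (x h)) (G \<zeta>))"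
    proof (intro mult_mono)
      \<comment> \<open>The label is constant on \<open>Q \<zeta>\<close>, so \<open>inj\<close>
        makes \<open>\<delta>\<close> alone injective there.\<close>
      have "inj_on (\<lambda>(g, h). \<delta> g h) (Q \<zeta>)"
      proof (rule inj_onI)
        fix p q assume "p \<in> Q \<zeta>" "q \<in> Q \<zeta>" "(\<lambda>(g, h). \<delta> g h) p = (\<lambda>(g, h). \<delta> g h) q"
        then show "p = q"
          by (intro inj_onD[OF inj]) (auto simp: Q_def case_prod_unfold)
      qed
      then have "L2_set (\<lambda>(g, h). cmod (\<alpha> (\<delta> g h))) (Q \<zeta>) =
          L2_set (\<lambda>d. cmod (\<alpha> d)) ((\<lambda>(g, h). \<delta> g h) ` Q \<zeta>)"
        by (simp add: L2_set_reindex o_def case_prod_unfold)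
      also have "\<dots> \<le> a"
        unfolding a_def using D by (intro L2_set_subset) (auto simp: Q_def)
      finally show "L2_set (\<lambda>(g, h). cmod (\<alpha> (\<delta> g h))) (Q \<zeta>) \<le> a" .
      show "L2_set (\<lambda>(g, h). cmod (y g) * cmod (x h)) (Q \<zeta>) \<le>
          L2_set (\<lambda>g. cmod (y g)) (G \<zeta>) * L2_set (\<lambda>h. cmod (x h)) (G \<zeta>)"
        unfolding L2_set_product[symmetric]
        using F P by (intro L2_set_subset) (fastforce simp: Q_def G_def)+
    qed (auto simp: a_def)
    finally show ?thesis by (simp add: mult_ac)
  qed
  have "cmod (\<Sum>(g, h)\<in>P. \<alpha> (\<delta> g h) * x h * cnj (y g)) \<le>
      (\<Sum>(g, h)\<in>P. cmod (\<alpha> (\<delta> g h)) * (cmod (y g) * cmod (x h)))"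
    by (rule sum_norm_le) (auto simp: norm_mult mult_ac)
  also have "\<dots> = (\<Sum>\<zeta>\<in>z ` F. \<Sum>(g, h)\<in>Q \<zeta>. cmod (\<alpha> (\<delta> g h)) * (cmod (y g) * cmod (x h)))"
    unfolding Q_def using F finP P(1)
    by (subst sum.group[where g = "\<lambda>p. z (fst p)"]) auto
  also have "\<dots> \<le> (\<Sum>\<zeta>\<in>z ` F. a * (L2_set (\<lambda>h. cmod (x h)) (G \<zeta>) * L2_set (\<lambda>g. cmod (y g)) (G \<zeta>)))"
    by (intro sum_mono Q)
  also have "\<dots> = a * (\<Sum>\<zeta>\<in>z ` F. L2_set (\<lambda>h. cmod (x h)) (G \<zeta>) * L2_set (\<lambda>g. cmod (y g)) (G \<zeta>))"
    by (simp add: sum_distrib_left)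
  \<comment> \<open>A second use of Cauchy-Schwarz, now over the labels; the fibres of
    \<open>z\<close> then reassemble to the norms over \<open>F\<close>.\<close>
  also have "\<dots> \<le> a * (L2_set (\<lambda>\<zeta>. L2_set (\<lambda>h. cmod (x h)) (G \<zeta>)) (z ` F) *
      L2_set (\<lambda>\<zeta>. L2_set (\<lambda>g. cmod (y g)) (G \<zeta>)) (z ` F))"
    using L2_set_mult_ineq[of "\<lambda>\<zeta>. L2_set (\<lambda>h. cmod (x h)) (G \<zeta>)" "\<lambda>\<zeta>. L2_set (\<lambda>g. cmod (y g)) (G \<zeta>)" "z ` F"]
    by (intro mult_left_mono) (auto simp: a_def)
  also have "\<dots> = a * (L2_set (\<lambda>h. cmod (x h)) F * L2_set (\<lambda>g. cmod (y g)) F)"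
    unfolding G_def by (simp only: L2_set_fibres[OF F])
  finally show ?thesis by (simp add: a_def)
qed

lemma sum_inverse_squares_le: "(\<Sum>j=1..M. 1 / (real j)\<^sup>2) \<le> 2"
proof -
  \<comment> \<open>The subtracted term makes the induction work, by telescoping 1/(M+1)^2 <= 1/M -
    1/(M+1).\<close>
  have "(\<Sum>j=1..M. 1 / (real j)\<^sup>2) \<le> 2 - 1 / real M" if "M \<ge> 1"
    using that
  proof (induction M rule: dec_induct)
    case (step M)
    have "1 / (real (Suc M))\<^sup>2 \<le> 1 / (real M * real (Suc M))"
      using step by (intro divide_left_mono) (auto simp: power2_eq_square)
    also have "\<dots> = 1 / real M - 1 / real (Suc M)"
      using step by (simp add: field_simps)
    finally show ?case using step by simp
  qed simp
  then show ?thesis by (cases "M \<ge> 1") (auto intro: order.trans)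
qed

section \<open>Finite matrices of convolution type\<close>

text \<open>Cauchy-Schwarz with the weights 1/(2j) and 2j. The first factor contributes a quarter of
  the sum of inverse squares, at most 1/2; the second is controlled by the weighted
  coefficients.\<close>

lemma even_coefficients_bound:
  fixes \<alpha> :: "'d \<Rightarrow> complex" and l :: "'d \<Rightarrow> nat"
  assumes "finite D" and coeff: "L2_set (\<lambda>d. real (l d) * cmod (\<alpha> d)) D \<le> 1"
  shows "(\<Sum>j=1..M. L2_set (\<lambda>d. cmod (\<alpha> d)) {d \<in> D. l d = 2 * j}) \<le> sqrt (1 / 2)"
proof -
  define a where "a j = L2_set (\<lambda>d. cmod (\<alpha> d)) {d \<in> D. l d = 2 * j}" for j
  have "(\<Sum>j=1..M. a j) = (\<Sum>j=1..M. \<bar>1 / (2 * real j)\<bar> * \<bar>2 * real j * a j\<bar>)"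
    by (rule sum.cong) (auto simp: a_def abs_mult)
  also have "\<dots> \<le> L2_set (\<lambda>j. 1 / (2 * real j)) {1..M} * L2_set (\<lambda>j. 2 * real j * a j) {1..M}"
    by (rule L2_set_mult_ineq)
  also have "\<dots> \<le> sqrt (1 / 2) * 1"
  proof (intro mult_mono)
    have "(\<Sum>j=1..M. (1 / (2 * real j))\<^sup>2) = (\<Sum>j=1..M. 1 / (real j)\<^sup>2) / 4"
      by (simp add: power_divide power_mult_distrib sum_divide_distrib mult.commute)
    then show "L2_set (\<lambda>j. 1 / (2 * real j)) {1..M} \<le> sqrt (1 / 2)"
      unfolding L2_set_def using sum_inverse_squares_le[of M]
      by (intro real_sqrt_le_mono) linarith
    define r where "r d = (real (l d) * cmod (\<alpha> d))\<^sup>2" for d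
    have "(\<Sum>j=1..M. (2 * real j * a j)\<^sup>2) = (\<Sum>j=1..M. \<Sum>d | d \<in> D \<and> l d = 2 * j. r d)"
      by (rule sum.cong)
        (auto simp: a_def L2_set_def sum_nonneg power_mult_distrib sum_distrib_left r_def)
    also have "\<dots> = (\<Sum>d\<in>(\<Union>j\<in>{1..M}. {d \<in> D. l d = 2 * j}). r d)"
      using assms(1) by (intro sum.UNION_disjoint[symmetric]) auto
    also have "\<dots> \<le> (\<Sum>d\<in>D. r d)"
      using assms(1) by (intro sum_mono2) (auto simp: r_def)
    also have "\<dots> \<le> 1"
      using coeff by (simp add: L2_set_def r_def)
    finally show "L2_set (\<lambda>j. 2 * real j * a j) {1..M} \<le> 1"
      by (simp add: L2_set_def)
  qed auto
  finally show ?thesis by (simp add: a_def)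
qed

context
  fixes X :: "'g::group_add set" and \<alpha> :: "'g \<Rightarrow> complex" and F :: "'g set"
  assumes free: "free_generators X" and F: "finite F" and \<alpha>0: "\<alpha> 0 = 0"
begin

text \<open>The diagonal pairs drop out because \<open>\<alpha> 0 = 0\<close>. The others are sorted
  by half the length of \<open>g - h\<close>, and each class is a partial convolution whose label is
  the suffix shared by \<open>g\<close> and \<open>h\<close>.\<close>

lemma sphere_blocks_bound:
  assumes coeff: "\<And>D. finite D \<Longrightarrow> L2_set (\<lambda>d. real (word_length X d) * cmod (\<alpha> d)) D \<le> 1"
  shows "cmod (\<Sum>(g, h) | (g, h) \<in> F \<times> F \<and> word_length X g = word_length X h. \<alpha> (g - h) * x h * cnj (y g))
    \<le> sqrt (1 / 2) * (L2_set (\<lambda>h. cmod (x h)) F * L2_set (\<lambda>g. cmod (y g)) F)"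
proof -
  define l where "l = word_length X"
  define w where "w = reduced_word X"
  define P where "P = {(g, h). (g, h) \<in> F \<times> F \<and> l g = l h}"
  define P' where "P' = {(g, h) \<in> P. g \<noteq> h}"
  define D where "D = (\<lambda>(g, h). g - h) ` (F \<times> F)"
  \<comment> \<open>A crude bound for all lengths that occur, making the range of \<open>j\<close>
    finite.\<close>
  define M where "M = (\<Sum>d\<in>D. l d)"
  define Q where "Q j = {p \<in> P'. l (fst p - snd p) div 2 = j}" for j
  define N where "N = L2_set (\<lambda>h. cmod (x h)) F * L2_set (\<lambda>g. cmod (y g)) F"
  let ?f = "\<lambda>(g, h). \<alpha> (g - h) * x h * cnj (y g)"
  have N: "0 \<le> N" by (simp add: N_def)
  have finD: "finite D" using F by (simp add: D_def)
  have finP: "finite P" by (rule finite_subset[of _ "F \<times> F"]) (use F in \<open>auto simp: P_def\<close>)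
  have lM: "l (g - h) \<le> M" if "g \<in> F" "h \<in> F" for g h
    unfolding M_def using finD that by (intro member_le_sum) (auto simp: D_def)
  have sphere: "\<exists>j\<ge>1. l (g - h) = 2 * j \<and> take j (w g) = take j (w (g - h)) \<and>
      drop j (w g) = drop j (w h)" if "(g, h) \<in> P'" for g h
    using that word_length_diff_sphere[OF free, of g h] unfolding P'_def P_def l_def w_def
    by (smt (verit) case_prodD mem_Collect_eq)
  have Q: "cmod (\<Sum>p\<in>Q j. ?f p) \<le> L2_set (\<lambda>d. cmod (\<alpha> d)) {d \<in> D. l d = 2 * j} * N" for j
  proof -
    have *: "l (g - h) = 2 * j \<and> take j (w g) = take j (w (g - h)) \<and> drop j (w g) = drop j (w h)
        \<and> g \<in> F \<and> h \<in> F" if "(g, h) \<in> Q j" for g h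
      using that sphere[of g h] by (auto simp: Q_def P'_def P_def)
    \<comment> \<open>The element \<open>g - h\<close> supplies the first \<open>j\<close> letters
      of \<open>w g\<close> and the label the remaining ones; this recovers \<open>g\<close>, and
      with it \<open>h\<close>.\<close>
    have "inj_on (\<lambda>(g, h). (drop j (w g), g - h)) (Q j)"
    proof (rule inj_onI, clarify)
      fix g h g' h' assume gh: "(g, h) \<in> Q j" "(g', h') \<in> Q j"
        "drop j (w g) = drop j (w g')" "g - h = g' - h'"
      then have "w g = w g'"
        using *[OF gh(1)] *[OF gh(2)] by (metis append_take_drop_id)
      then have "g = g'"
        using reduced_word_inject[OF free] by (simp add: w_def)
      with gh(4) show "g = g' \<and> h = h'" by (metis diff_add_cancel minus_diff_eq)
    qed
    then show ?thesis
      unfolding N_def using * F finD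
      by (intro partial_convolution_bound[where z = "\<lambda>g. drop j (w g)" and \<delta> = "\<lambda>g h. g - h"])
        (auto simp: D_def)
  qed
  have "(\<Sum>p\<in>P. ?f p) = (\<Sum>p\<in>P'. ?f p)"
    using finP \<alpha>0 by (intro sum.mono_neutral_right) (auto simp: P'_def)
  also have "\<dots> = (\<Sum>j=1..M. \<Sum>p\<in>Q j. ?f p)"
  proof -
    have "(\<lambda>p. l (fst p - snd p) div 2) ` P' \<subseteq> {1..M}"
    proof clarify
      fix g h assume "(g, h) \<in> P'"
      then show "l (fst (g, h) - snd (g, h)) div 2 \<in> {1..M}"
        using sphere[of g h] lM[of g h] by (auto simp: P'_def P_def)
    qed
    moreover have "finite P'" using finP by (auto simp: P'_def intro: finite_subset)
    ultimately show ?thesis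
      unfolding Q_def by (intro sum.group[symmetric]) auto
  qed
  finally have "cmod (\<Sum>p\<in>P. ?f p) \<le> (\<Sum>j=1..M. L2_set (\<lambda>d. cmod (\<alpha> d)) {d \<in> D. l d = 2 * j} * N)"
    using Q by (simp add: sum_norm_le)
  also have "\<dots> = (\<Sum>j=1..M. L2_set (\<lambda>d. cmod (\<alpha> d)) {d \<in> D. l d = 2 * j}) * N"
    by (simp add: sum_distrib_right)
  also have "\<dots> \<le> sqrt (1 / 2) * N"
    unfolding l_def by (intro mult_right_mono N even_coefficients_bound finD coeff)
  finally show ?thesis by (simp add: P_def N_def l_def)
qed

text \<open>The terms of the quadratic form are read as coefficients of a trigonometric polynomial
  with frequency \<open>l g - l h\<close>. The Bohr inequality bounds the nonzero frequencies, and
  frequency 0 is the part on single spheres.\<close>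

lemma convolution_matrix_bound:
  assumes coeff: "\<And>D. finite D \<Longrightarrow> L2_set (\<lambda>d. real (word_length X d) * cmod (\<alpha> d)) D \<le> 1"
    and comm: "\<And>x y. cmod (\<Sum>(g, h)\<in>F \<times> F.
        (of_nat (word_length X g) - of_nat (word_length X h)) * \<alpha> (g - h) * x h * cnj (y g))
      \<le> L2_set (\<lambda>h. cmod (x h)) F * L2_set (\<lambda>g. cmod (y g)) F"
  shows "cmod (\<Sum>(g, h)\<in>F \<times> F. \<alpha> (g - h) * x h * cnj (y g))
    \<le> 5 / 2 * (L2_set (\<lambda>h. cmod (x h)) F * L2_set (\<lambda>g. cmod (y g)) F)"
proof -
  define l where "l = word_length X"
  define N where "N = L2_set (\<lambda>h. cmod (x h)) F * L2_set (\<lambda>g. cmod (y g)) F"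
  define f where "f = (\<lambda>(g, h). \<alpha> (g - h) * x h * cnj (y g))"
  define d where "d = (\<lambda>(g, h). int (l g) - int (l h))"
  have "cmod (\<Sum>p\<in>F \<times> F. of_int (d p) * f p * cis (t * real_of_int (d p))) \<le> N" for t
  proof -
    \<comment> \<open>The phases are moved into the vectors, which keep their norms; hence
      \<open>comm\<close> gives a bound uniform in \<open>t\<close>. This is conjugation by the
      unitaries generated by the length operator.\<close>
    define x' where "x' h = cis (- (t * real (l h))) * x h" for h
    define y' where "y' g = cis (- (t * real (l g))) * y g" for g
    have "(\<Sum>p\<in>F \<times> F. of_int (d p) * f p * cis (t * real_of_int (d p))) =
        (\<Sum>(g, h)\<in>F \<times> F. (of_nat (l g) - of_nat (l h)) * \<alpha> (g - h) * x' h * cnj (y' g))"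
    proof (rule sum.cong[OF refl], clarify)
      fix g h
      have "cis (t * (real (l g) - real (l h))) = cis (- (t * real (l h))) * cis (t * real (l g))"
        by (simp add: cis_mult algebra_simps)
      then show "of_int (d (g, h)) * f (g, h) * cis (t * real_of_int (d (g, h))) =
          (of_nat (l g) - of_nat (l h)) * \<alpha> (g - h) * x' h * cnj (y' g)"
        by (simp add: d_def f_def x'_def y'_def cis_cnj)
    qed
    then show ?thesis
      using comm[of x' y'] by (simp add: l_def N_def x'_def y'_def norm_mult)
  qed
  then have "cmod (\<Sum>p | p \<in> F \<times> F \<and> d p \<noteq> 0. f p) \<le> pi / 2 * N"
    using F by (intro trig_poly_bohr) auto
  moreover have "cmod (\<Sum>p | p \<in> F \<times> F \<and> d p = 0. f p) \<le> sqrt (1 / 2) * N"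
  proof -
    have "{p \<in> F \<times> F. d p = 0} =
        {(g, h). (g, h) \<in> F \<times> F \<and> word_length X g = word_length X h}"
      by (auto simp: d_def l_def)
    then show ?thesis
      using sphere_blocks_bound[OF coeff, of x y] by (simp add: f_def N_def)
  qed
  moreover have "(\<Sum>p\<in>F \<times> F. f p) =
      (\<Sum>p | p \<in> F \<times> F \<and> d p \<noteq> 0. f p) + (\<Sum>p | p \<in> F \<times> F \<and> d p = 0. f p)"
    using F by (subst sum.union_disjoint[symmetric]) (auto intro!: sum.cong)
  ultimately have "cmod (\<Sum>p\<in>F \<times> F. f p) \<le> (pi / 2 + sqrt (1 / 2)) * N"
    by (smt (verit) norm_triangle_ineq distrib_right)
  also have "\<dots> \<le> 5 / 2 * N"
  proof (rule mult_right_mono)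
    \<comment> \<open>8/5 + 9/10 = 5/2.\<close>
    have "sqrt (1 / 2) \<le> 9 / 10" by (rule real_le_lsqrt) (auto simp: power2_eq_square)
    then show "pi / 2 + sqrt (1 / 2) \<le> 5 / 2" using pi_le_16_5 by linarith
  qed (simp add: N_def)
  finally show ?thesis by (simp add: f_def N_def)
qed

end

section \<open>Geometry of the Hilbert space\<close>

lemma cinner_commute: "cinner \<xi> \<eta> = cnj (cinner \<eta> \<xi>)"
  unfolding cinner_def infsum_cnj[symmetric] by (simp add: mult.commute)

lemma cinner_add_left: "cinner (\<xi> + \<eta>) \<zeta> = cinner \<xi> \<zeta> + cinner \<eta> \<zeta>"
  unfolding cinner_def coord_plus distrib_right by (rule infsum_add; rule cinner_summable)

lemma cinner_scaleC_left: "cinner (scaleC c \<xi>) \<zeta> = c * cinner \<xi> \<zeta>"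
  unfolding cinner_def coord_scaleC mult.assoc by (rule infsum_cmult_right; rule cinner_summable)

lemma cinner_add_right: "cinner \<zeta> (\<xi> + \<eta>) = cinner \<zeta> \<xi> + cinner \<zeta> \<eta>"
  by (subst (1 2 3) cinner_commute) (simp add: cinner_add_left)

lemma cinner_scaleC_right: "cinner \<zeta> (scaleC c \<xi>) = cnj c * cinner \<zeta> \<xi>"
  by (subst (1 2) cinner_commute) (simp add: cinner_scaleC_left)

lemma scaleR_eq_scaleC: "r *\<^sub>R \<xi> = scaleC (complex_of_real r) \<xi>"
  by (simp add: scaleR_ell2_def)

lemma uminus_eq_scaleC: "- \<xi> = scaleC (- 1) \<xi>"
  by (rule ell2_eqI) (simp add: coord_simps)

lemma cinner_diff_left: "cinner (\<xi> - \<eta>) \<zeta> = cinner \<xi> \<zeta> - cinner \<eta> \<zeta>"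
  using cinner_add_left[of \<xi> "scaleC (- 1) \<eta>" \<zeta>]
  unfolding cinner_scaleC_left by (simp flip: uminus_eq_scaleC)

lemma cinner_diff_right: "cinner \<zeta> (\<xi> - \<eta>) = cinner \<zeta> \<xi> - cinner \<zeta> \<eta>"
  by (subst (1 2 3) cinner_commute) (simp add: cinner_diff_left)

text \<open>Multiplying \<open>\<xi>\<close> by a scalar of modulus at most 1 (0 if the inner
  product vanishes) turns the inner product into its modulus, which reduces the claim to the real
  Cauchy-Schwarz inequality.\<close>

lemma norm_cinner_le: "cmod (cinner \<xi> \<eta>) \<le> norm \<xi> * norm \<eta>"
proof -
  define c where "c = cnj (sgn (cinner \<xi> \<eta>))"
  have "c * cinner \<xi> \<eta> = complex_of_real (cmod (cinner \<xi> \<eta>))"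
    by (simp add: c_def sgn_eq complex_norm_square[symmetric] power2_eq_square mult.commute[of "cnj _"])
  then have "cmod (cinner \<xi> \<eta>) = inner (scaleC c \<xi>) \<eta>"
    by (simp add: inner_ell2_def cinner_scaleC_left)
  also have "\<dots> \<le> norm (scaleC c \<xi>) * norm \<eta>"
    by (rule norm_cauchy_schwarz)
  also have "\<dots> \<le> norm \<xi> * norm \<eta>"
    by (intro mult_right_mono) (auto simp: norm_scaleC c_def norm_sgn)
  finally show ?thesis .
qed

lemma bounded_linear_cinner_left: "bounded_linear (\<lambda>\<xi>. cinner \<xi> \<eta>)"
  by (rule bounded_linear_intro[where K = "norm \<eta>"])
    (auto simp: cinner_add_left scaleR_eq_scaleC cinner_scaleC_left scaleR_conv_of_real norm_cinner_le)

text \<open>Infinite \<open>F\<close> gives the zero vector, so that the function is total.\<close>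

lift_definition finvec :: "'g set \<Rightarrow> ('g \<Rightarrow> complex) \<Rightarrow> 'g ell2"
  is "\<lambda>F x g. if finite F \<and> g \<in> F then x g else 0"
proof -
  fix F :: "'g set" and x :: "'g \<Rightarrow> complex"
  have "(\<lambda>g. (cmod (if finite F \<and> g \<in> F then x g else 0))\<^sup>2) summable_on (if finite F then F else {})"
    by (rule summable_on_finite) auto
  then show "(\<lambda>g. (cmod (if finite F \<and> g \<in> F then x g else 0))\<^sup>2) summable_on UNIV"
    by (rule summable_on_cong_neutral[THEN iffD1, rotated 3]) (auto split: if_splits)
qed

abbreviation delta :: "'g \<Rightarrow> 'g ell2" where
  "delta h \<equiv> finvec {h} (\<lambda>_. 1)"

lemma coord_finvec: "finite F \<Longrightarrow> coord (finvec F x) g = (if g \<in> F then x g else 0)"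
  by transfer simp

lemma cinner_finvec_right:
  assumes "finite F"
  shows "cinner \<xi> (finvec F y) = (\<Sum>g\<in>F. coord \<xi> g * cnj (y g))"
proof -
  have "cinner \<xi> (finvec F y) = (\<Sum>\<^sub>\<infinity>g\<in>F. coord \<xi> g * cnj (y g))"
    unfolding cinner_def using assms by (intro infsum_cong_neutral) (auto simp: coord_finvec)
  then show ?thesis using assms by simp
qed

lemma cinner_finvec_left:
  assumes "finite F"
  shows "cinner (finvec F x) \<xi> = (\<Sum>g\<in>F. x g * cnj (coord \<xi> g))"
  by (subst cinner_commute) (simp add: cinner_finvec_right assms mult.commute)

lemma norm_finvec:
  assumes "finite F"
  shows "norm (finvec F x) = L2_set (\<lambda>g. cmod (x g)) F"
proof -
  have "cinner (finvec F x) (finvec F x) = (\<Sum>g\<in>F. complex_of_real ((cmod (x g))\<^sup>2))"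
    using assms by (auto simp: cinner_finvec_right coord_finvec complex_norm_square[symmetric]
        simp del: of_real_power intro!: sum.cong)
  then show ?thesis
    by (simp add: norm_ell2_def inner_ell2_def L2_set_def flip: of_real_power)
qed

lemma norm_coord_le: "cmod (coord \<xi> g) \<le> norm \<xi>"
  using norm_cinner_le[of \<xi> "delta g"] by (simp add: cinner_finvec_right norm_finvec)

lemma coord_sum: "coord (\<Sum>i\<in>A. \<xi> i) g = (\<Sum>i\<in>A. coord (\<xi> i) g)"
  by (induction A rule: infinite_finite_induct) (auto simp: coord_simps)

lemma finvec_eq_sum:
  assumes "finite F"
  shows "finvec F x = (\<Sum>h\<in>F. scaleC (x h) (delta h))"
  using assms by (intro ell2_eqI) (auto simp: coord_sum coord_scaleC coord_finvec if_distrib sum.delta cong: if_cong)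

text \<open>By Pythagoras the squared error of a truncation is \<open>(norm \<xi>)\<^sup>2\<close>
  minus a finite partial sum of the series for it. Statements about finite vectors thus pass to all
  vectors by continuity.\<close>

lemma tendsto_finvec: "((\<lambda>F. finvec F (coord \<xi>)) \<longlongrightarrow> \<xi>) (finite_subsets_at_top UNIV)"
proof -
  define s where "s F = (\<Sum>g\<in>F. (cmod (coord \<xi> g))\<^sup>2)" for F
  have norm2: "(norm (finvec F (coord \<xi>) - \<xi>))\<^sup>2 = (norm \<xi>)\<^sup>2 - s F" if "finite F" for F
  proof -
    have "inner \<xi> (finvec F (coord \<xi>)) = s F"
      using that by (simp add: inner_ell2_def cinner_finvec_right s_def complex_norm_square[symmetric] del: of_real_power)
    moreover have "(norm (finvec F (coord \<xi>)))\<^sup>2 = s F"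
      using that by (simp add: norm_finvec L2_set_def s_def sum_nonneg)
    ultimately show ?thesis
      by (simp add: power2_norm_eq_inner inner_diff inner_commute)
  qed
  have "(s \<longlongrightarrow> (norm \<xi>)\<^sup>2) (finite_subsets_at_top UNIV)"
    using has_sum_infsum[OF coord_summable[of \<xi>]]
    by (simp add: has_sum_def s_def[abs_def] norm_ell2_eq infsum_nonneg)
  then have "((\<lambda>F. (norm \<xi>)\<^sup>2 - s F) \<longlongrightarrow> (norm \<xi>)\<^sup>2 - (norm \<xi>)\<^sup>2) (finite_subsets_at_top UNIV)"
    by (intro tendsto_intros)
  moreover have "\<forall>\<^sub>F F in finite_subsets_at_top UNIV.
      (norm \<xi>)\<^sup>2 - s F = (norm (finvec F (coord \<xi>) - \<xi>))\<^sup>2"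
    using norm2 by (auto intro: eventually_mono[OF eventually_finite_subsets_at_top_weakI])
  ultimately have "((\<lambda>F. (norm (finvec F (coord \<xi>) - \<xi>))\<^sup>2) \<longlongrightarrow> (norm \<xi>)\<^sup>2 - (norm \<xi>)\<^sup>2)
      (finite_subsets_at_top UNIV)"
    by (rule Lim_transform_eventually)
  then have "((\<lambda>F. (norm (finvec F (coord \<xi>) - \<xi>))\<^sup>2) \<longlongrightarrow> 0) (finite_subsets_at_top UNIV)"
    by (simp only: diff_self)
  then have "((\<lambda>F. sqrt ((norm (finvec F (coord \<xi>) - \<xi>))\<^sup>2)) \<longlongrightarrow> sqrt 0) (finite_subsets_at_top UNIV)"
    by (rule tendsto_real_sqrt)
  then show ?thesis
    by (subst tendsto_iff) (auto simp: tendsto_iff dist_norm)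
qed

section \<open>Bounded operators and their adjoints\<close>

lemma bounded_operatorsD:
  "T \<in> bounded_operators \<Longrightarrow> blinfun_apply T (scaleC c \<xi>) = scaleC c (blinfun_apply T \<xi>)"
  by (simp add: bounded_operators_def)

lemma apply_finvec:
  assumes "T \<in> bounded_operators" "finite F"
  shows "blinfun_apply T (finvec F x) = (\<Sum>h\<in>F. scaleC (x h) (blinfun_apply T (delta h)))"
  by (subst finvec_eq_sum[OF assms(2)]) (simp add: blinfun.sum_right bounded_operatorsD[OF assms(1)])

lemma coord_apply_finvec:
  assumes "T \<in> bounded_operators" "finite F"
  shows "coord (blinfun_apply T (finvec F x)) g = (\<Sum>h\<in>F. x h * coord (blinfun_apply T (delta h)) g)"
  by (subst apply_finvec[OF assms]) (simp add: coord_sum coord_scaleC)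

lemma cinner_apply_finvec:
  assumes "T \<in> bounded_operators" "finite F"
  shows "cinner (blinfun_apply T (finvec F x)) (finvec F y) =
    (\<Sum>(g, h)\<in>F \<times> F. coord (blinfun_apply T (delta h)) g * x h * cnj (y g))"
  unfolding cinner_finvec_right[OF assms(2)] coord_apply_finvec[OF assms] sum_distrib_right
    sum.cartesian_product
  by (intro sum.cong refl) auto

text \<open>The bound is tested on truncations of \<open>\<xi>\<close> and of its image
  \<open>\<eta>\<close>. In the limit the left side becomes the square of
  \<open>norm \<eta>\<close>, and one factor cancels.\<close>

lemma norm_le_matrix_bound:
  assumes T: "T \<in> bounded_operators" and C: "0 \<le> C"
    and bound: "\<And>F x y. finite F \<Longrightarrow>
      cmod (\<Sum>(g, h)\<in>F \<times> F. coord (blinfun_apply T (delta h)) g * x h * cnj (y g))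
        \<le> C * (L2_set (\<lambda>h. cmod (x h)) F * L2_set (\<lambda>g. cmod (y g)) F)"
  shows "norm T \<le> C"
proof (rule norm_blinfun_bound[OF C])
  fix \<xi>
  define \<eta> where "\<eta> = blinfun_apply T \<xi>"
  let ?fs = "finite_subsets_at_top UNIV"
  have "\<forall>\<^sub>F F in ?fs. inner (blinfun_apply T (finvec F (coord \<xi>))) (finvec F (coord \<eta>))
      \<le> C * (norm (finvec F (coord \<xi>)) * norm (finvec F (coord \<eta>)))"
  proof (rule eventually_finite_subsets_at_top_weakI)
    fix F :: "'a set" assume F: "finite F"
    show "inner (blinfun_apply T (finvec F (coord \<xi>))) (finvec F (coord \<eta>))
        \<le> C * (norm (finvec F (coord \<xi>)) * norm (finvec F (coord \<eta>)))"
      unfolding inner_ell2_def cinner_apply_finvec[OF T F] norm_finvec[OF F]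
      by (rule order.trans[OF complex_Re_le_cmod bound[OF F]])
  qed
  moreover have "((\<lambda>F. inner (blinfun_apply T (finvec F (coord \<xi>))) (finvec F (coord \<eta>)))
      \<longlongrightarrow> inner (blinfun_apply T \<xi>) \<eta>) ?fs"
    by (intro tendsto_inner bounded_linear.tendsto[OF blinfun.bounded_linear_right] tendsto_finvec)
  moreover have "((\<lambda>F. C * (norm (finvec F (coord \<xi>)) * norm (finvec F (coord \<eta>))))
      \<longlongrightarrow> C * (norm \<xi> * norm \<eta>)) ?fs"
    by (intro tendsto_mult tendsto_const tendsto_norm tendsto_finvec)
  ultimately have "inner (blinfun_apply T \<xi>) \<eta> \<le> C * (norm \<xi> * norm \<eta>)"
    by (intro tendsto_le[where F = ?fs]) auto
  then have "norm \<eta> * norm \<eta> \<le> (C * norm \<xi>) * norm \<eta>"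
    by (simp add: \<eta>_def power2_norm_eq_inner[symmetric] power2_eq_square mult_ac)
  then show "norm (blinfun_apply T \<xi>) \<le> C * norm \<xi>"
    using C by (cases "norm \<eta> = 0") (auto simp: \<eta>_def)
qed

text \<open>The square of the norm of S \<eta> is the inner product of T (S \<eta>) with \<eta>.
  Applied to differences, this gives norm continuity of the adjoint.\<close>

lemma norm_adjoint_le:
  assumes "is_adjoint S T"
  shows "norm S \<le> norm T"
proof (rule norm_blinfun_bound)
  fix \<eta>
  let ?S = "blinfun_apply S \<eta>"
  have "inner ?S ?S = inner (blinfun_apply T ?S) \<eta>"
    using assms by (simp add: is_adjoint_def inner_ell2_def)
  also have "\<dots> \<le> norm (blinfun_apply T ?S) * norm \<eta>"
    by (rule norm_cauchy_schwarz)
  also have "\<dots> \<le> (norm T * norm ?S) * norm \<eta>"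
    by (intro mult_right_mono norm_blinfun) simp
  finally have "norm ?S * norm ?S \<le> (norm T * norm \<eta>) * norm ?S"
    by (simp add: power2_norm_eq_inner[symmetric] power2_eq_square mult_ac)
  then show "norm ?S \<le> norm T * norm \<eta>"
    by (cases "norm ?S = 0") auto
qed simp

lemma adjoint_exists:
  fixes T :: "'g ell2_op"
  assumes T: "T \<in> bounded_operators"
  shows "\<exists>S. is_adjoint S T"
proof -
  \<comment> \<open>The coordinates of the adjoint's value at \<open>\<eta>\<close> are forced by
    testing the adjoint relation on \<open>delta h\<close>.\<close>
  define s where "s \<eta> h = cinner \<eta> (blinfun_apply T (delta h))" for \<eta> h
  have fin: "(\<Sum>h\<in>F. (cmod (s \<eta> h))\<^sup>2) \<le> (norm T * norm \<eta>)\<^sup>2" if F: "finite F" for F \<eta>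
  proof -
    define n where "n = norm (finvec F (s \<eta>))"
    have n2: "n\<^sup>2 = (\<Sum>h\<in>F. (cmod (s \<eta> h))\<^sup>2)"
      using F by (simp add: n_def norm_finvec L2_set_def sum_nonneg)
    \<comment> \<open>Testing \<open>T\<close> on the truncation of \<open>s \<eta>\<close> itself
      gives n^2 <= |T| n |\<eta>|; cancelling \<open>n\<close> leaves a bound independent of
      \<open>F\<close>, hence square-summability.\<close>
    have "cinner (blinfun_apply T (finvec F (s \<eta>))) \<eta> = (\<Sum>h\<in>F. s \<eta> h * cinner (blinfun_apply T (delta h)) \<eta>)"
      by (subst apply_finvec[OF T F])
        (simp add: linear_sum[OF bounded_linear.linear[OF bounded_linear_cinner_left]] cinner_scaleC_left)
    also have "\<dots> = (\<Sum>h\<in>F. complex_of_real ((cmod (s \<eta> h))\<^sup>2))"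
      unfolding s_def complex_norm_square by (intro sum.cong refl) (metis cinner_commute)
    also have "\<dots> = complex_of_real (n\<^sup>2)"
      by (simp add: n2)
    finally have "n\<^sup>2 = cmod (cinner (blinfun_apply T (finvec F (s \<eta>))) \<eta>)"
      by (simp flip: of_real_power)
    also have "\<dots> \<le> norm (blinfun_apply T (finvec F (s \<eta>))) * norm \<eta>"
      by (rule norm_cinner_le)
    also have "\<dots> \<le> (norm T * n) * norm \<eta>"
      unfolding n_def by (intro mult_right_mono norm_blinfun) simp
    finally have "n * n \<le> (norm T * norm \<eta>) * n"
      by (simp add: power2_eq_square mult_ac)
    then have "n \<le> norm T * norm \<eta>"
      by (cases "n = 0") (auto simp: n_def)
    then show ?thesis
      unfolding n2[symmetric] by (intro power_mono) (auto simp: n_def)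
  qed
  have summable: "(\<lambda>h. (cmod (s \<eta> h))\<^sup>2) summable_on UNIV" for \<eta>
    by (rule nonneg_bdd_above_summable_on) (auto intro!: bdd_aboveI2[where M = "(norm T * norm \<eta>)\<^sup>2"] fin)
  define S where "S \<eta> = Abs_ell2 (s \<eta>)" for \<eta>
  have coord_S: "coord (S \<eta>) h = s \<eta> h" for \<eta> h
    using summable[of \<eta>] by (simp add: S_def Abs_ell2_inverse)
  have "bounded_linear S"
  proof (rule bounded_linear_intro[where K = "norm T"])
    show "S (\<xi> + \<eta>) = S \<xi> + S \<eta>" for \<xi> \<eta>
      by (rule ell2_eqI) (simp add: coord_S coord_simps s_def cinner_add_left)
    show "S (r *\<^sub>R \<xi>) = r *\<^sub>R S \<xi>" for r \<xi>
      by (rule ell2_eqI) (simp add: coord_S coord_simps s_def scaleR_eq_scaleC cinner_scaleC_left)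
    show "norm (S \<eta>) \<le> norm \<eta> * norm T" for \<eta>
    proof -
      have "(\<Sum>\<^sub>\<infinity>h. (cmod (s \<eta> h))\<^sup>2) \<le> (norm T * norm \<eta>)\<^sup>2"
        using summable fin by (intro infsum_le_finite_sums) auto
      then have "norm (S \<eta>) \<le> sqrt ((norm T * norm \<eta>)\<^sup>2)"
        unfolding norm_ell2_eq coord_S by (rule real_sqrt_le_mono)
      then show ?thesis by (simp add: mult.commute)
    qed
  qed
  then have apply_S: "blinfun_apply (Blinfun S) = S"
    by (rule bounded_linear_Blinfun_apply)
  have "cinner (blinfun_apply T \<xi>) \<eta> = cinner \<xi> (S \<eta>)" for \<xi> \<eta>
  proof -
    let ?fs = "finite_subsets_at_top UNIV"
    \<comment> \<open>The relation holds by construction for finitely supported vectors; both sides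
      are continuous in \<open>\<xi>\<close>.\<close>
    have "\<forall>\<^sub>F F in ?fs. cinner (blinfun_apply T (finvec F (coord \<xi>))) \<eta> = cinner (finvec F (coord \<xi>)) (S \<eta>)"
    proof (rule eventually_finite_subsets_at_top_weakI)
      fix F :: "'g set" assume F: "finite F"
      have "cinner (blinfun_apply T (finvec F (coord \<xi>))) \<eta> =
          (\<Sum>h\<in>F. coord \<xi> h * cinner (blinfun_apply T (delta h)) \<eta>)"
        by (subst apply_finvec[OF T F])
          (simp add: linear_sum[OF bounded_linear.linear[OF bounded_linear_cinner_left]] cinner_scaleC_left)
      also have "\<dots> = cinner (finvec F (coord \<xi>)) (S \<eta>)"
        unfolding cinner_finvec_left[OF F] coord_S s_def
        by (intro sum.cong refl) (metis cinner_commute)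
      finally show "cinner (blinfun_apply T (finvec F (coord \<xi>))) \<eta> = cinner (finvec F (coord \<xi>)) (S \<eta>)" .
    qed
    moreover have "((\<lambda>F. cinner (blinfun_apply T (finvec F (coord \<xi>))) \<eta>)
        \<longlongrightarrow> cinner (blinfun_apply T \<xi>) \<eta>) ?fs"
      by (intro bounded_linear.tendsto[OF bounded_linear_cinner_left]
          bounded_linear.tendsto[OF blinfun.bounded_linear_right] tendsto_finvec)
    ultimately have "((\<lambda>F. cinner (finvec F (coord \<xi>)) (S \<eta>))
        \<longlongrightarrow> cinner (blinfun_apply T \<xi>) \<eta>) ?fs"
      by (simp cong: tendsto_cong)
    moreover have "((\<lambda>F. cinner (finvec F (coord \<xi>)) (S \<eta>)) \<longlongrightarrow> cinner \<xi> (S \<eta>)) ?fs"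
      by (intro bounded_linear.tendsto[OF bounded_linear_cinner_left] tendsto_finvec)
    ultimately show ?thesis
      by (rule tendsto_unique[rotated]) simp
  qed
  then show ?thesis
    by (auto simp: is_adjoint_def apply_S intro!: exI[of _ "Blinfun S"])
qed

section \<open>The reduced group C*-algebra\<close>

lemma scale_op_add: "scale_op c (S + T) = scale_op c S + scale_op c T"
  by (rule blinfun_eqI) (simp add: scale_op_apply blinfun.add_left scaleC_add_right)

lemma scale_op_scaleR: "scale_op c (r *\<^sub>R T) = r *\<^sub>R scale_op c T"
  by (rule blinfun_eqI) (simp add: scale_op_apply blinfun.scaleR_left scaleC_scaleR)

lemma scaleR_eq_scale_op: "r *\<^sub>R T = scale_op (complex_of_real r) T"
  by (rule blinfun_eqI) (simp add: scale_op_apply blinfun.scaleR_left scaleR_eq_scaleC)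

lemma scale_op_1 [simp]: "scale_op 1 T = T"
  using scaleR_eq_scale_op[of 1 T] by simp

lemma scale_op_0 [simp]: "scale_op 0 T = 0"
  using scaleR_eq_scale_op[of 0 T] by simp

lemma scale_op_scale_op [simp]: "scale_op c (scale_op d T) = scale_op (c * d) T"
  by (rule blinfun_eqI, rule ell2_eqI) (simp add: scale_op_apply coord_scaleC)

lemma norm_scale_op_le: "norm (scale_op c T) \<le> cmod c * norm T"
  by (rule norm_blinfun_bound)
    (auto simp: scale_op_apply norm_scaleC mult.assoc intro!: mult_left_mono norm_blinfun)

lemma bounded_linear_scale_op: "bounded_linear (scale_op c)"
  by (rule bounded_linear_intro[where K = "cmod c"])
    (auto simp: scale_op_add scale_op_scaleR norm_scale_op_le mult.commute)

lemma bounded_linear_coord: "bounded_linear (\<lambda>\<xi>. coord \<xi> g)"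
  by (rule bounded_linear_intro[where K = 1]) (auto simp: coord_simps scaleR_conv_of_real norm_coord_le)

lemma bounded_linear_matrix_entry:
  "bounded_linear (\<lambda>T :: 'g ell2_op. coord (blinfun_apply T \<xi>) g)"
  by (rule bounded_linear_compose[OF bounded_linear_coord blinfun.bounded_linear_left])

section \<open>Adjoints and products of translations\<close>

lemma is_adjoint_0: "is_adjoint 0 0"
  by (simp add: is_adjoint_def cinner_def coord_zero)

lemma is_adjoint_add: "is_adjoint S T \<Longrightarrow> is_adjoint S' T' \<Longrightarrow> is_adjoint (S + S') (T + T')"
  by (simp add: is_adjoint_def blinfun.add_left cinner_add_left cinner_add_right)

lemma is_adjoint_diff: "is_adjoint S T \<Longrightarrow> is_adjoint S' T' \<Longrightarrow> is_adjoint (S - S') (T - T')"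
  by (simp add: is_adjoint_def blinfun.diff_left cinner_diff_left cinner_diff_right)

lemma is_adjoint_scale_op: "is_adjoint S T \<Longrightarrow> is_adjoint (scale_op (cnj c) S) (scale_op c T)"
  by (simp add: is_adjoint_def scale_op_apply cinner_scaleC_left cinner_scaleC_right)

lemma is_adjoint_id: "is_adjoint id_blinfun id_blinfun"
  by (simp add: is_adjoint_def)

lemma is_adjoint_left_regular: "is_adjoint (left_regular (- g)) (left_regular g)"
proof -
  have "cinner (translate g \<xi>) \<eta> = cinner \<xi> (translate (- g) \<eta>)" for \<xi> \<eta> :: "'a ell2"
    unfolding cinner_def coord_translate
    by (rule infsum_reindex_bij_witness[where i = "\<lambda>x. g + x" and j = "\<lambda>x. - g + x"])
      (auto simp: add.assoc[symmetric])
  then show ?thesis by (simp add: is_adjoint_def left_regular_apply)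
qed

lemma id_blinfun_compose [simp]: "id_blinfun o\<^sub>L T = T"
  by (rule blinfun_eqI) simp

lemma left_regular_0: "left_regular 0 = id_blinfun"
  by (rule blinfun_eqI, rule ell2_eqI) (simp add: left_regular_apply coord_translate)

lemma left_regular_compose:
  "scale_op c (left_regular g) o\<^sub>L scale_op d (left_regular h) = scale_op (c * d) (left_regular (g + h))"
  by (rule blinfun_eqI, rule ell2_eqI)
    (simp add: scale_op_apply left_regular_apply coord_scaleC coord_translate minus_add add.assoc
      del: add_uminus_conv_diff)

text \<open>The span is over the reals; complex multiples of the translations as generators make it
  the complex group algebra.\<close>

definition group_algebra :: "'g::group_add ell2_op set" where
  "group_algebra = span (range (\<lambda>(c, g). scale_op c (left_regular g)))"

lemma group_algebra_gen: "scale_op c (left_regular g) \<in> group_algebra"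
  unfolding group_algebra_def by (rule span_base) auto

lemma subspace_group_algebra: "subspace group_algebra"
  by (simp add: group_algebra_def)

lemma group_algebra_induct [consumes 1, case_names subspace gen]:
  assumes "a \<in> group_algebra" "subspace {a. P a}" "\<And>c g. P (scale_op c (left_regular g))"
  shows "P a"
  using assms(1) unfolding group_algebra_def
  by (rule span_induct) (use assms(2,3) in auto)

lemma group_algebra_scale_op:
  assumes "a \<in> group_algebra"
  shows "scale_op c a \<in> group_algebra"
  using assms
proof (induction rule: group_algebra_induct)
  case subspace
  show ?case
    using linear_subspace_vimage[OF bounded_linear.linear[OF bounded_linear_scale_op] subspace_group_algebra]
    by (simp add: vimage_def)
qed (simp add: group_algebra_gen)

lemma group_algebra_compose:
  assumes "a \<in> group_algebra" "b \<in> group_algebra"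
  shows "a o\<^sub>L b \<in> group_algebra"
  using assms(1)
proof (induction rule: group_algebra_induct)
  case subspace
  show ?case
    using linear_subspace_vimage[OF bounded_linear.linear[OF
          bounded_bilinear.bounded_linear_left[OF bounded_bilinear_blinfun_compose]] subspace_group_algebra]
    by (simp add: vimage_def)
next
  case (gen c g)
  show ?case using assms(2)
  proof (induction rule: group_algebra_induct)
    case subspace
    let ?l = "scale_op c (left_regular g)"
    show ?case
      using linear_subspace_vimage[OF bounded_linear.linear[OF
            bounded_bilinear.bounded_linear_right[OF bounded_bilinear_blinfun_compose]] subspace_group_algebra]
      by (simp add: vimage_def)
  qed (simp add: left_regular_compose group_algebra_gen)
qed

lemma group_algebra_adjoint:
  assumes "a \<in> group_algebra"
  shows "\<exists>b\<in>group_algebra. is_adjoint b a"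
  using assms
proof (induction rule: group_algebra_induct)
  case subspace
  show ?case
  proof (rule subspaceI)
    show "0 \<in> {a. \<exists>b\<in>group_algebra. is_adjoint b a}"
      using is_adjoint_0 subspace_0[OF subspace_group_algebra] by auto
    show "x + y \<in> {a. \<exists>b\<in>group_algebra. is_adjoint b a}"
      if "x \<in> {a. \<exists>b\<in>group_algebra. is_adjoint b a}" "y \<in> {a. \<exists>b\<in>group_algebra. is_adjoint b a}" for x y
      using that is_adjoint_add subspace_add[OF subspace_group_algebra] by blast
    show "r *\<^sub>R x \<in> {a. \<exists>b\<in>group_algebra. is_adjoint b a}"
      if "x \<in> {a. \<exists>b\<in>group_algebra. is_adjoint b a}" for r x
      using that is_adjoint_scale_op group_algebra_scale_op unfolding scaleR_eq_scale_op by blast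
  qed
qed (use is_adjoint_scale_op[OF is_adjoint_left_regular] group_algebra_gen in blast)

section \<open>The norm closure of the group algebra\<close>

lemma subspace_bounded_operators: "subspace bounded_operators"
  by (rule subspaceI)
    (auto simp: bounded_operators_def blinfun.add_left blinfun.scaleR_left scaleC_add_right scaleC_scaleR
      intro!: ell2_eqI simp: coord_simps)

lemma closed_bounded_operators: "closed bounded_operators"
proof -
  have eq: "bounded_operators = (\<Inter>c. \<Inter>\<xi>. {T :: 'a ell2_op. blinfun_apply T (scaleC c \<xi>) = scaleC c (blinfun_apply T \<xi>)})"
    by (auto simp: bounded_operators_def)
  show ?thesis
    unfolding eq
  proof (intro closed_INT ballI)
    show "closed {T :: 'a ell2_op. blinfun_apply T (scaleC c \<xi>) = scaleC c (blinfun_apply T \<xi>)}" for c \<xi>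
    by (intro closed_Collect_eq linear_continuous_on blinfun.bounded_linear_left
        bounded_linear_compose[OF bounded_linear_scaleC])
  qed
qed

lemma closure_group_algebra_subset_bounded_operators: "closure group_algebra \<subseteq> bounded_operators"
proof (rule closure_minimal[OF _ closed_bounded_operators])
  have "scale_op c (left_regular g) \<in> bounded_operators" for c and g :: 'a
    by (auto simp: bounded_operators_def scale_op_apply left_regular_apply coord_simps coord_translate
        intro!: ell2_eqI)
  then show "group_algebra \<subseteq> (bounded_operators :: 'a ell2_op set)"
    unfolding group_algebra_def by (intro span_minimal subspace_bounded_operators) auto
qed

text \<open>Adjoints of approximants in the group algebra approximate the adjoint equally well,
  since passing to adjoints does not increase the norm of a difference.\<close>

lemma closure_group_algebra_adjoint:
  assumes a: "a \<in> closure group_algebra"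
  shows "\<exists>b\<in>closure group_algebra. is_adjoint b a"
proof -
  obtain b where b: "is_adjoint b a"
    using adjoint_exists closure_group_algebra_subset_bounded_operators a by blast
  have "b \<in> closure group_algebra"
    unfolding closure_approachable
  proof (intro allI impI)
    fix e :: real assume "0 < e"
    then obtain a' where a': "a' \<in> group_algebra" "dist a' a < e"
      using a unfolding closure_approachable by blast
    then obtain b' where b': "b' \<in> group_algebra" "is_adjoint b' a'"
      using group_algebra_adjoint by blast
    then show "\<exists>b'\<in>group_algebra. dist b' b < e"
      using norm_adjoint_le[OF is_adjoint_diff[OF b'(2) b]] a'(2)
      by (intro bexI[of _ b']) (auto simp: dist_norm)
  qed
  with b show ?thesis by blast
qed

lemma cstar_subalgebra_closure_group_algebra: "cstar_subalgebra (closure group_algebra)"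
  unfolding cstar_subalgebra_def
proof (intro conjI ballI allI)
  show "0 \<in> closure group_algebra"
    using subspace_0[OF subspace_group_algebra] closure_subset by blast
  fix a :: "'a ell2_op" assume a: "a \<in> closure group_algebra"
  show "\<exists>b\<in>closure group_algebra. is_adjoint b a"
    by (rule closure_group_algebra_adjoint[OF a])
  obtain f where f: "\<And>n. f n \<in> group_algebra" "f \<longlonglongrightarrow> a"
    using a unfolding closure_sequential by blast
  show "scale_op c a \<in> closure group_algebra" for c
    unfolding closure_sequential using f
    by (intro exI[of _ "\<lambda>n. scale_op c (f n)"] conjI allI group_algebra_scale_op
        bounded_linear.tendsto[OF bounded_linear_scale_op])
  fix b :: "'a ell2_op" assume b: "b \<in> closure group_algebra"
  obtain h where h: "\<And>n. h n \<in> group_algebra" "h \<longlonglongrightarrow> b"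
    using b unfolding closure_sequential by blast
  show "a + b \<in> closure group_algebra"
    unfolding closure_sequential using f h
    by (intro exI[of _ "\<lambda>n. f n + h n"] conjI allI subspace_add[OF subspace_group_algebra] tendsto_add)
  show "a o\<^sub>L b \<in> closure group_algebra"
    unfolding closure_sequential using f h
    by (intro exI[of _ "\<lambda>n. f n o\<^sub>L h n"] conjI allI group_algebra_compose
        bounded_bilinear.tendsto[OF bounded_bilinear_blinfun_compose])
qed (simp_all add: closure_group_algebra_subset_bounded_operators)

text \<open>With this description, a linear and norm-closed property of all elements needs checking
  only on multiples of translations.\<close>

lemma reduced_group_cstar_eq: "reduced_group_cstar = closure group_algebra"
proof (intro equalityI)
  have "range left_regular \<subseteq> closure group_algebra"
    using group_algebra_gen[of 1] closure_subset by fastforce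
  then show "reduced_group_cstar \<subseteq> (closure group_algebra :: 'a ell2_op set)"
    unfolding reduced_group_cstar_def cstar_generated_def
    using cstar_subalgebra_closure_group_algebra by blast
  have "closure group_algebra \<subseteq> A" if A: "cstar_subalgebra A" "range left_regular \<subseteq> A" for A :: "'a ell2_op set"
  proof (rule closure_minimal)
    show "closed A" using A by (simp add: cstar_subalgebra_def)
    have "subspace A"
      using A(1) by (intro subspaceI) (auto simp: cstar_subalgebra_def scaleR_eq_scale_op)
    then show "group_algebra \<subseteq> A"
      unfolding group_algebra_def using A by (intro span_minimal) (auto simp: cstar_subalgebra_def image_subset_iff)
  qed
  then show "closure group_algebra \<subseteq> (reduced_group_cstar :: 'a ell2_op set)"
    unfolding reduced_group_cstar_def cstar_generated_def by blast
qed

lemma id_in_reduced_group_cstar: "id_blinfun \<in> reduced_group_cstar"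
  unfolding reduced_group_cstar_eq left_regular_0[symmetric]
  using group_algebra_gen[of 1 0] closure_subset by auto

text \<open>Translations have this convolution form, and the identity is linear and norm-closed in
  \<open>a\<close>. The coefficients are the coordinates of the image of \<open>delta 0\<close>,
  where 0 is the neutral element.\<close>

lemma reduced_group_cstar_matrix:
  assumes "a \<in> reduced_group_cstar"
  shows "coord (blinfun_apply a (delta h)) g = coord (blinfun_apply a (delta 0)) (g - h)"
proof -
  let ?Q = "{a :: 'a ell2_op. coord (blinfun_apply a (delta h)) g = coord (blinfun_apply a (delta 0)) (g - h)}"
  have "closed ?Q"
    by (intro closed_Collect_eq linear_continuous_on bounded_linear_matrix_entry)
  moreover have "group_algebra \<subseteq> ?Q"
    unfolding group_algebra_def
  proof (rule span_minimal)
    show "subspace ?Q"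
      by (rule subspaceI) (auto simp: blinfun.add_left blinfun.scaleR_left coord_simps)
    \<comment> \<open>The entry of the translation by \<open>k\<close> at \<open>(g, h)\<close> is 1
      exactly when \<open>- k + g = h\<close>.\<close>
    have "- k + g = h \<longleftrightarrow> - k + (g - h) = 0" for k
      by (metis add.assoc diff_conv_add_uminus eq_iff_diff_eq_0)
    then show "range (\<lambda>(c, g). scale_op c (left_regular g)) \<subseteq> ?Q"
      by (auto simp: scale_op_apply left_regular_apply coord_scaleC coord_translate coord_finvec)
  qed
  ultimately show ?thesis
    using assms closure_minimal[of group_algebra ?Q] unfolding reduced_group_cstar_eq by blast
qed

section \<open>States\<close>

context
  fixes A :: "'g ell2_op set" and \<phi>
  assumes A: "cstar_subalgebra A" and \<phi>: "\<phi> \<in> states A" and id: "id_blinfun \<in> A"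
begin

lemma state_add: "a \<in> A \<Longrightarrow> b \<in> A \<Longrightarrow> \<phi> (a + b) = \<phi> a + \<phi> b"
  using \<phi> by (simp add: states_def)

lemma state_scale_op: "a \<in> A \<Longrightarrow> \<phi> (scale_op c a) = c * \<phi> a"
  using \<phi> by (simp add: states_def)

lemma state_positive: "a \<in> A \<Longrightarrow> b \<in> A \<Longrightarrow> is_adjoint b a \<Longrightarrow> \<phi> (b o\<^sub>L a) \<in> \<real>\<^sub>\<ge>\<^sub>0"
  using \<phi> by (simp add: states_def)

lemma state_sup: "(SUP a\<in>{a\<in>A. norm a \<le> 1}. ennreal (cmod (\<phi> a))) = 1"
  using \<phi> by (simp add: states_def)

lemma state_norm_le_1:
  assumes "a \<in> A" "norm a \<le> 1"
  shows "cmod (\<phi> a) \<le> 1"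
proof -
  have "ennreal (cmod (\<phi> a)) \<le> 1"
    unfolding state_sup[symmetric] using assms by (intro SUP_upper) auto
  then show ?thesis by simp
qed

lemma state_norm_le:
  assumes "a \<in> A"
  shows "cmod (\<phi> a) \<le> norm a"
proof (cases "a = 0")
  case True
  then show ?thesis using state_scale_op[OF assms, of 0] by simp
next
  case False
  define r where "r = 1 / norm a"
  have r: "0 < r" using False by (simp add: r_def)
  have "norm (scale_op (of_real r) a) \<le> 1"
    using norm_scale_op_le[of "of_real r" a] False by (simp add: r_def norm_divide)
  then have "cmod (\<phi> (scale_op (of_real r) a)) \<le> 1"
    using A assms by (intro state_norm_le_1) (auto simp: cstar_subalgebra_def)
  then have "r * cmod (\<phi> a) \<le> 1"
    using r by (simp add: state_scale_op assms norm_mult)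
  then show ?thesis using False by (simp add: r_def field_simps)
qed

text \<open>Positivity on \<open>(a + c)\<^sup>* (a + c)\<close> for \<open>c = 1, \<i>\<close> and \<open>c = - \<phi>(a) / \<bar>\<phi>(a)\<bar>\<^sup>2\<close>.\<close>

lemma state_cauchy_schwarz:
  assumes a: "a \<in> A" "norm a \<le> 1"
  shows "(cmod (\<phi> a))\<^sup>2 \<le> Re (\<phi> id_blinfun)"
proof (cases "\<phi> a = 0")
  case True
  then show ?thesis
    using state_positive[OF id id is_adjoint_id] by (simp add: complex_nonneg_Reals_iff)
next
  case False
  obtain b where b: "b \<in> A" "is_adjoint b a"
    using A a by (auto simp: cstar_subalgebra_def)
  have mult: "x o\<^sub>L y \<in> A" and plus: "x + y \<in> A" and scale: "scale_op c x \<in> A"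
    if "x \<in> A" "y \<in> A" for x y c
    using A that by (auto simp: cstar_subalgebra_def)
  define p where "p = \<phi> id_blinfun"
  define q where "q = \<phi> (b o\<^sub>L a)"
  have p: "Im p = 0"
    using state_positive[OF id id is_adjoint_id] by (simp add: complex_nonneg_Reals_iff p_def)
  have q: "Im q = 0" "Re q \<le> 1"
  proof -
    have q: "q \<in> \<real>\<^sub>\<ge>\<^sub>0" unfolding q_def by (rule state_positive[OF a(1) b])
    then show "Im q = 0" by (simp add: complex_nonneg_Reals_iff)
    have "norm (b o\<^sub>L a) \<le> norm b * norm a"
      by (rule norm_blinfun_compose)
    also have "\<dots> \<le> 1 * 1"
      using a(2) norm_adjoint_le[OF b(2)] by (intro mult_mono) auto
    finally have "cmod q \<le> 1"
      unfolding q_def using a b mult by (intro state_norm_le_1) auto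
    then show "Re q \<le> 1" using complex_Re_le_cmod order.trans by blast
  qed
  have pos: "q + c * \<phi> b + cnj c * \<phi> a + cnj c * c * p \<in> \<real>\<^sub>\<ge>\<^sub>0" for c
  proof -
    have "(b + scale_op (cnj c) id_blinfun) o\<^sub>L (a + scale_op c id_blinfun) =
        (((b o\<^sub>L a) + scale_op c b) + scale_op (cnj c) a) + scale_op (cnj c * c) id_blinfun"
      using b(1) A
      by (intro blinfun_eqI ell2_eqI)
        (auto simp: blinfun.add_left blinfun.add_right scale_op_apply coord_simps
          bounded_operatorsD cstar_subalgebra_def subset_iff algebra_simps)
    moreover have "is_adjoint (b + scale_op (cnj c) id_blinfun) (a + scale_op c id_blinfun)"
      by (intro is_adjoint_add is_adjoint_scale_op is_adjoint_id b)
    ultimately have "\<phi> ((((b o\<^sub>L a) + scale_op c b) + scale_op (cnj c) a) + scale_op (cnj c * c) id_blinfun) \<in> \<real>\<^sub>\<ge>\<^sub>0"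
      using state_positive[of "a + scale_op c id_blinfun" "b + scale_op (cnj c) id_blinfun"]
        plus scale a(1) b(1) id by metis
    then show ?thesis
      using a(1) b(1) id by (simp add: state_add state_scale_op plus scale mult p_def q_def)
  qed
  \<comment> \<open>Reality of the value at \<open>c = 1\<close> gives opposite imaginary parts, at
    \<open>c = \<i>\<close> equal real parts.\<close>
  have "\<phi> b = cnj (\<phi> a)"
    using pos[of 1] pos[of \<i>] p q by (auto simp: complex_nonneg_Reals_iff complex_eq_iff)
  define s where "s = (cmod (\<phi> a))\<^sup>2"
  have s: "0 < s" using False by (simp add: s_def)
  have s': "\<phi> a * cnj (\<phi> a) = of_real s" by (simp only: s_def complex_norm_square)
  \<comment> \<open>At this scale the cross terms add up to -2, so \<open>Re q \<le> 1\<close>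
    leaves \<open>1 \<le> Re p / s\<close>. There is no division by \<open>p\<close>, which might
    still be 0.\<close>
  define c where "c = - \<phi> a / of_real s"
  have "c * \<phi> b = - 1" "cnj c * \<phi> a = - 1" "cnj c * c = 1 / of_real s"
    using s s' by (simp_all add: c_def \<open>\<phi> b = cnj (\<phi> a)\<close> field_simps mult.commute[of "cnj _"] power2_eq_square)
  then have "q - 2 + p / of_real s \<in> \<real>\<^sub>\<ge>\<^sub>0"
    using pos[of c] by simp
  then have "0 \<le> Re q - 2 + Re p / s"
    by (simp add: complex_nonneg_Reals_iff)
  then have "1 \<le> Re p / s" using q by linarith
  then show ?thesis using s by (simp add: s_def p_def field_simps)
qed

text \<open>The norm bound gives \<open>p \<le> 1\<close>. Conversely all values on the unit ball
  are at most \<open>sqrt p\<close> in modulus, while their supremum is 1.\<close>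

lemma state_id: "\<phi> id_blinfun = 1"
proof -
  define p where "p = Re (\<phi> id_blinfun)"
  have \<phi>p: "\<phi> id_blinfun = of_real p" and p: "0 \<le> p"
    using state_positive[OF id id is_adjoint_id]
    by (simp_all add: complex_nonneg_Reals_iff p_def complex_eq_iff)
  have "p \<le> 1"
    using state_norm_le_1[OF id] norm_blinfun_id_le \<phi>p p by simp
  moreover have "(SUP a\<in>{a\<in>A. norm a \<le> 1}. ennreal (cmod (\<phi> a))) \<le> ennreal (sqrt p)"
    using state_cauchy_schwarz by (intro SUP_least ennreal_leI real_le_rsqrt) (auto simp: p_def)
  then have "1 \<le> p"
    unfolding state_sup by simp
  ultimately show ?thesis using \<phi>p by simp
qed

end

section \<open>Commutators with the length operator\<close>

lemma norm_le_coordwise: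
  assumes "0 \<le> K" "\<And>x. cmod (coord \<xi> x) \<le> K * cmod (coord \<eta> x)"
  shows "norm \<xi> \<le> K * norm \<eta>"
proof -
  have "(\<Sum>\<^sub>\<infinity>x. (cmod (coord \<xi> x))\<^sup>2) \<le> (\<Sum>\<^sub>\<infinity>x. K\<^sup>2 * (cmod (coord \<eta> x))\<^sup>2)"
    unfolding power_mult_distrib[symmetric] using assms
    by (intro infsum_mono coord_summable power_mono)
      (auto simp: power_mult_distrib intro!: summable_on_cmult_right coord_summable)
  also have "\<dots> = K\<^sup>2 * (\<Sum>\<^sub>\<infinity>x. (cmod (coord \<eta> x))\<^sup>2)"
    by (rule infsum_cmult_right) (rule coord_summable)
  finally have "norm \<xi> \<le> sqrt (K\<^sup>2 * (\<Sum>\<^sub>\<infinity>x. (cmod (coord \<eta> x))\<^sup>2))"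
    unfolding norm_ell2_eq by (rule real_sqrt_le_mono)
  then show ?thesis
    using assms(1) by (simp add: norm_ell2_eq real_sqrt_mult)
qed

lemma L2_set_coord_le: "L2_set (\<lambda>g. cmod (coord \<xi> g)) F \<le> norm \<xi>"
proof (cases "finite F")
  case True
  then have "(\<Sum>g\<in>F. (cmod (coord \<xi> g))\<^sup>2) \<le> (\<Sum>\<^sub>\<infinity>g. (cmod (coord \<xi> g))\<^sup>2)"
    by (intro finite_sum_le_infsum coord_summable) auto
  then show ?thesis
    unfolding L2_set_def norm_ell2_eq by (rule real_sqrt_le_mono)
qed simp

lemma finvec_in_dom_D:
  assumes "finite F"
  shows "finvec F x \<in> dom_D l"
proof -
  have "(\<lambda>g. (real (l g))\<^sup>2 * (cmod (coord (finvec F x) g))\<^sup>2) summable_on F"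
    by (rule summable_on_finite[OF assms])
  then show ?thesis
    unfolding dom_D_def mem_Collect_eq
    by (rule summable_on_cong_neutral[THEN iffD1, rotated 3]) (auto simp: coord_finvec assms)
qed

lemma op_D_finvec: "finite F \<Longrightarrow> op_D l (finvec F x) = finvec F (\<lambda>g. of_nat (l g) * x g)"
  by (rule ell2_eqI) (auto simp: coord_op_D finvec_in_dom_D coord_finvec)

context
  fixes l :: "'g::group_add \<Rightarrow> nat" and a :: "'g ell2_op"
  assumes l0: "l 0 = 0" and comm: "commutator_norm_le l a 1"
begin

lemma coefficients_bound:
  assumes "finite F"
  shows "L2_set (\<lambda>g. real (l g) * cmod (coord (blinfun_apply a (delta 0)) g)) F \<le> 1"
proof -
  have dom: "blinfun_apply a (delta 0) \<in> dom_D l"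
    using comm finvec_in_dom_D[of "{0}" "\<lambda>_. 1" l] by (auto simp: commutator_norm_le_def)
  \<comment> \<open>Hence the commutator maps \<open>delta 0\<close> to \<open>op_D l\<close> of its
    image, whose coordinates are the weighted coefficients.\<close>
  have "op_D l (delta 0) = 0"
    by (rule ell2_eqI) (simp add: op_D_finvec coord_finvec coord_zero l0)
  moreover have "norm (op_D l (blinfun_apply a (delta 0)) - blinfun_apply a (op_D l (delta 0))) \<le> 1 * norm (delta 0 :: 'g ell2)"
    using comm finvec_in_dom_D[of "{0}" "\<lambda>_. 1" l] unfolding commutator_norm_le_def by blast
  ultimately have "norm (op_D l (blinfun_apply a (delta 0))) \<le> 1"
    by (simp add: norm_finvec)
  then show ?thesis
    using L2_set_coord_le[of "op_D l (blinfun_apply a (delta 0))" F]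
    by (simp add: coord_op_D[OF dom] norm_mult)
qed

text \<open>The sum is the quadratic form of the commutator, whose matrix entries are those of
  \<open>a\<close> times \<open>l g - l h\<close>, on finitely supported vectors; these lie in the
  domain.\<close>

lemma commutator_matrix_bound:
  assumes a: "a \<in> bounded_operators" and F: "finite F"
  shows "cmod (\<Sum>(g, h)\<in>F \<times> F.
      (of_nat (l g) - of_nat (l h)) * coord (blinfun_apply a (delta h)) g * x h * cnj (y g))
    \<le> L2_set (\<lambda>h. cmod (x h)) F * L2_set (\<lambda>g. cmod (y g)) F"
proof -
  define \<xi> where "\<xi> = finvec F x"
  have \<xi>: "\<xi> \<in> dom_D l" and a\<xi>: "blinfun_apply a \<xi> \<in> dom_D l"
    using comm finvec_in_dom_D[OF F, of x l] by (auto simp: \<xi>_def commutator_norm_le_def)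
  define \<zeta> where "\<zeta> = op_D l (blinfun_apply a \<xi>) - blinfun_apply a (op_D l \<xi>)"
  have "cinner \<zeta> (finvec F y) = (\<Sum>g\<in>F. \<Sum>h\<in>F.
      (of_nat (l g) - of_nat (l h)) * coord (blinfun_apply a (delta h)) g * x h * cnj (y g))"
  proof (unfold cinner_finvec_right[OF F], rule sum.cong[OF refl])
    fix g
    have "coord \<zeta> g = of_nat (l g) * (\<Sum>h\<in>F. x h * coord (blinfun_apply a (delta h)) g) -
        (\<Sum>h\<in>F. of_nat (l h) * x h * coord (blinfun_apply a (delta h)) g)"
      unfolding \<zeta>_def coord_minus coord_op_D[OF a\<xi>]
      unfolding \<xi>_def op_D_finvec[OF F] coord_apply_finvec[OF a F] ..
    also have "\<dots> = (\<Sum>h\<in>F. (of_nat (l g) - of_nat (l h)) * coord (blinfun_apply a (delta h)) g * x h)"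
      unfolding sum_distrib_left sum_subtractf[symmetric]
      by (intro sum.cong refl) (simp add: algebra_simps)
    finally show "coord \<zeta> g * cnj (y g) = (\<Sum>h\<in>F.
        (of_nat (l g) - of_nat (l h)) * coord (blinfun_apply a (delta h)) g * x h * cnj (y g))"
      by (simp add: sum_distrib_right)
  qed
  then have "cmod (\<Sum>(g, h)\<in>F \<times> F.
      (of_nat (l g) - of_nat (l h)) * coord (blinfun_apply a (delta h)) g * x h * cnj (y g))
    = cmod (cinner \<zeta> (finvec F y))"
    by (simp add: sum.cartesian_product)
  also have "\<dots> \<le> norm \<zeta> * norm (finvec F y)"
    by (rule norm_cinner_le)
  also have "\<dots> \<le> norm \<xi> * norm (finvec F y)"
    using comm \<xi> unfolding commutator_norm_le_def \<zeta>_def by (intro mult_right_mono) auto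
  finally show ?thesis
    by (simp add: \<xi>_def norm_finvec F)
qed

end

text \<open>A supply of admissible elements with which \<open>d_length\<close> separates states. The
  commutator with a translation has weights of modulus at most \<open>l g\<close>; adding 1 in the
  denominator covers \<open>l g = 0\<close>.\<close>

lemma commutator_left_regular:
  fixes l :: "'g::group_add \<Rightarrow> nat"
  assumes l: "\<And>g h. \<bar>real (l (g + h)) - real (l h)\<bar> \<le> real (l g)"
  shows "commutator_norm_le l (scale_op (of_real (1 / (real (l g) + 1))) (left_regular g)) 1"
proof -
  define r where "r = 1 / (real (l g) + 1)"
  define a where "a = scale_op (of_real r) (left_regular g)"
  have r: "0 < r" "r * real (l g) \<le> 1" by (auto simp: r_def field_simps)
  have coord_a: "coord (blinfun_apply a \<xi>) x = of_real r * coord \<xi> (- g + x)" for \<xi> x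
    by (simp add: a_def scale_op_apply left_regular_apply coord_scaleC coord_translate)
  have diff: "\<bar>real (l x) - real (l (- g + x))\<bar> \<le> real (l g)" for x
    using l[of g "- g + x"] by (simp add: add.assoc[symmetric])
  have dom: "blinfun_apply a \<xi> \<in> dom_D l" if \<xi>: "\<xi> \<in> dom_D l" for \<xi>
    unfolding dom_D_def mem_Collect_eq
  proof (rule summable_on_comparison_test)
    \<comment> \<open>By (s + t)^2 <= 2 s^2 + 2 t^2 the weight splits into a part with
      \<open>l g\<close>, controlled by \<open>?\<eta>\<close>, and a part with
      \<open>l (- g + x)\<close>, controlled by \<open>?\<zeta>\<close>.\<close>
    let ?\<eta> = "blinfun_apply a \<xi>" and ?\<zeta> = "blinfun_apply a (op_D l \<xi>)"
    show "(\<lambda>x. 2 * ((real (l g))\<^sup>2 * (cmod (coord ?\<eta> x))\<^sup>2) + 2 * (cmod (coord ?\<zeta> x))\<^sup>2) summable_on UNIV"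
      by (intro summable_on_add summable_on_cmult_right coord_summable)
    fix x
    have "(real (l x))\<^sup>2 \<le> (real (l g) + real (l (- g + x)))\<^sup>2"
      using diff[of x] by (intro power_mono) auto
    also have "\<dots> \<le> 2 * (real (l g))\<^sup>2 + 2 * (real (l (- g + x)))\<^sup>2"
      using sum_squares_bound[of "real (l g)" "real (l (- g + x))"] by (simp add: power2_sum)
    finally have "(real (l x))\<^sup>2 * (cmod (coord ?\<eta> x))\<^sup>2 \<le>
        (2 * (real (l g))\<^sup>2 + 2 * (real (l (- g + x)))\<^sup>2) * (cmod (coord ?\<eta> x))\<^sup>2"
      by (rule mult_right_mono) simp
    then show "(real (l x))\<^sup>2 * (cmod (coord ?\<eta> x))\<^sup>2 \<le>
        2 * ((real (l g))\<^sup>2 * (cmod (coord ?\<eta> x))\<^sup>2) + 2 * (cmod (coord ?\<zeta> x))\<^sup>2"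
      by (simp add: coord_a coord_op_D[OF \<xi>] norm_mult power_mult_distrib algebra_simps)
  qed auto
  have "norm (op_D l (blinfun_apply a \<xi>) - blinfun_apply a (op_D l \<xi>)) \<le> 1 * norm \<xi>"
    if \<xi>: "\<xi> \<in> dom_D l" for \<xi>
  proof -
    \<comment> \<open>Coordinate \<open>x\<close> of the commutator involves \<open>\<xi>\<close> at
      \<open>- g + x\<close>, so the coordinatewise comparison is with the translate, which has the
      same norm.\<close>
    have "norm (op_D l (blinfun_apply a \<xi>) - blinfun_apply a (op_D l \<xi>)) \<le> 1 * norm (translate g \<xi>)"
    proof (rule norm_le_coordwise)
      fix x
      have "coord (op_D l (blinfun_apply a \<xi>) - blinfun_apply a (op_D l \<xi>)) x =
          of_real (r * (real (l x) - real (l (- g + x)))) * coord \<xi> (- g + x)"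
        by (simp add: coord_minus coord_op_D dom \<xi> coord_a algebra_simps)
      also have "cmod \<dots> = (r * \<bar>real (l x) - real (l (- g + x))\<bar>) * cmod (coord \<xi> (- g + x))"
        using r by (simp only: norm_mult norm_of_real abs_mult abs_of_pos)
      also have "\<dots> \<le> 1 * cmod (coord \<xi> (- g + x))"
      proof (rule mult_right_mono)
        show "r * \<bar>real (l x) - real (l (- g + x))\<bar> \<le> 1"
          using mult_left_mono[OF diff[of x], of r] r by linarith
      qed simp
      finally show "cmod (coord (op_D l (blinfun_apply a \<xi>) - blinfun_apply a (op_D l \<xi>)) x) \<le>
          1 * cmod (coord (translate g \<xi>) x)"
        by (simp add: coord_translate)
    qed simp
    then show ?thesis by (simp add: norm_translate)
  qed
  then show ?thesis
    unfolding commutator_norm_le_def a_def[symmetric] r_def[symmetric] using dom by blast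
qed

section \<open>The metric on the state space\<close>

text \<open>States are contractive and agree on multiples of the identity, so twice the norm of
  \<open>a\<close> minus such a multiple bounds the difference.\<close>

lemma state_difference_le:
  fixes X :: "'g::group_add set"
  assumes free: "free_generators X"
    and a: "a \<in> reduced_group_cstar" and comm: "commutator_norm_le (word_length X) a 1"
    and \<phi>: "\<phi> \<in> states reduced_group_cstar" and \<psi>: "\<psi> \<in> states reduced_group_cstar"
  shows "cmod (\<phi> a - \<psi> a) \<le> 5"
proof -
  let ?A = "reduced_group_cstar :: 'g ell2_op set"
  have A: "cstar_subalgebra ?A"
    by (simp add: reduced_group_cstar_eq cstar_subalgebra_closure_group_algebra)
  note id = id_in_reduced_group_cstar
  define \<alpha> where "\<alpha> = coord (blinfun_apply a (delta 0))"
  \<comment> \<open>These are the coefficients of \<open>b\<close>, which is \<open>a\<close> minus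
    \<open>\<alpha> 0\<close> times the identity.\<close>
  define \<beta> where "\<beta> d = (if d = 0 then 0 else \<alpha> d)" for d
  define c where "c = scale_op (- \<alpha> 0) (id_blinfun :: 'g ell2_op)"
  define b where "b = a + c"
  have c: "c \<in> ?A" and b: "b \<in> ?A" and bd: "a \<in> bounded_operators" "b \<in> bounded_operators"
    using A a id unfolding cstar_subalgebra_def c_def b_def by blast+
  have \<beta>: "coord (blinfun_apply b (delta h)) g = \<beta> (g - h)" for g h
    using reduced_group_cstar_matrix[OF a, of h g]
    by (auto simp: b_def c_def \<beta>_def \<alpha>_def blinfun.add_left scale_op_apply coord_simps coord_finvec)
  have eq: "\<phi> a - \<psi> a = \<phi> b - \<psi> b"
    using a c \<phi> \<psi> by (simp add: b_def state_add[OF A] c_def state_scale_op[OF A] state_id[OF A] id)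
  have "norm b \<le> 5 / 2"
  proof (rule norm_le_matrix_bound[OF bd(2)])
    fix F :: "'g set" and x y :: "'g \<Rightarrow> complex" assume F: "finite F"
    show "cmod (\<Sum>(g, h)\<in>F \<times> F. coord (blinfun_apply b (delta h)) g * x h * cnj (y g))
        \<le> 5 / 2 * (L2_set (\<lambda>h. cmod (x h)) F * L2_set (\<lambda>g. cmod (y g)) F)"
      unfolding \<beta>
    proof (rule convolution_matrix_bound[OF free F])
      show "\<beta> 0 = 0" by (simp add: \<beta>_def)
      show "L2_set (\<lambda>d. real (word_length X d) * cmod (\<beta> d)) D \<le> 1" if "finite D" for D
      proof -
        have "real (word_length X d) * cmod (\<beta> d) = real (word_length X d) * cmod (\<alpha> d)" for d
          by (simp add: \<beta>_def word_length_0[OF free])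
        then show ?thesis
          using coefficients_bound[OF word_length_0[OF free] comm that] by (simp only: \<alpha>_def)
      qed
      fix x y :: "'g \<Rightarrow> complex"
      \<comment> \<open>\<open>\<alpha>\<close> and \<open>\<beta>\<close> can differ only for
        \<open>g = h\<close>, where the length difference vanishes; thus the commutator bound for
        \<open>a\<close> serves for \<open>b\<close>.\<close>
      have "(of_nat (word_length X g) - of_nat (word_length X h)) * \<beta> (g - h) =
          (of_nat (word_length X g) - of_nat (word_length X h)) * coord (blinfun_apply a (delta h)) g" for g h
        using reduced_group_cstar_matrix[OF a, of h g] by (simp add: \<beta>_def \<alpha>_def)
      then show "cmod (\<Sum>(g, h)\<in>F \<times> F.
          (of_nat (word_length X g) - of_nat (word_length X h)) * \<beta> (g - h) * x h * cnj (y g))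
          \<le> L2_set (\<lambda>h. cmod (x h)) F * L2_set (\<lambda>g. cmod (y g)) F"
        using commutator_matrix_bound[OF word_length_0[OF free] comm bd(1) F] by (simp only:)
    qed
  qed simp
  moreover have "cmod (\<phi> a - \<psi> a) \<le> norm b + norm b"
    unfolding eq
    by (rule order.trans[OF norm_triangle_ineq4]) (intro add_mono state_norm_le[OF A] \<phi> \<psi> id b)
  ultimately show ?thesis by linarith
qed

text \<open>Linearity extends the agreement to the group algebra and contractivity to its closure;
  off the algebra both functions are \<open>undefined\<close>.\<close>

lemma states_eqI:
  fixes \<phi> \<psi> :: "'g::group_add ell2_op \<Rightarrow> complex"
  assumes \<phi>: "\<phi> \<in> states reduced_group_cstar" and \<psi>: "\<psi> \<in> states reduced_group_cstar"
    and eq: "\<And>g. \<phi> (left_regular g) = \<psi> (left_regular g)"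
  shows "\<phi> = \<psi>"
proof (rule extensionalityI[of _ reduced_group_cstar])
  let ?A = "reduced_group_cstar :: 'g ell2_op set"
  have A: "cstar_subalgebra ?A"
    by (simp add: reduced_group_cstar_eq cstar_subalgebra_closure_group_algebra)
  note id = id_in_reduced_group_cstar
  have alg: "group_algebra \<subseteq> ?A"
    using closure_subset by (simp add: reduced_group_cstar_eq)
  note add = state_add[OF A \<phi> id] state_add[OF A \<psi> id]
  note scale = state_scale_op[OF A \<phi> id] state_scale_op[OF A \<psi> id]
  have Asub: "0 \<in> ?A" "x + y \<in> ?A" "scale_op c x \<in> ?A" if "x \<in> ?A" "y \<in> ?A" for x y c
    using A that by (auto simp: cstar_subalgebra_def)
  have dense: "a \<in> ?A \<and> \<phi> a = \<psi> a" if "a \<in> group_algebra" for a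
    using that
  proof (induction rule: group_algebra_induct)
    case subspace
    show ?case
    proof (rule subspaceI)
      show "0 \<in> {a. a \<in> ?A \<and> \<phi> a = \<psi> a}"
        using scale[OF id, of 0] Asub(1)[OF id id] by simp
    qed (auto simp: add Asub scaleR_eq_scale_op scale)
  next
    case (gen c g)
    have "left_regular g \<in> ?A"
      using group_algebra_gen[of 1 g] alg by auto
    then show ?case by (simp add: scale eq Asub)
  qed
  show "\<phi> \<in> extensional ?A" "\<psi> \<in> extensional ?A"
    using \<phi> \<psi> by (auto simp: states_def)
  fix a :: "'g ell2_op" assume a: "a \<in> ?A"
  have "cmod (\<phi> a - \<psi> a) \<le> e" if "0 < e" for e
  proof -
    obtain a' where a': "a' \<in> group_algebra" "dist a' a < e / 2"
      using a \<open>0 < e\<close> unfolding reduced_group_cstar_eq closure_approachable by (meson half_gt_zero)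
    \<comment> \<open>The difference is written through \<open>+\<close> and
      \<open>scale_op\<close>, the operations in which states are linear by definition.\<close>
    define b where "b = a + scale_op (- 1) a'"
    have "b = a - a'"
      using scaleR_eq_scale_op[of "- 1" a'] by (simp add: b_def)
    then have nb: "norm b \<le> e / 2"
      using a'(2) by (simp add: dist_norm norm_minus_commute)
    have b: "b \<in> ?A"
      using dense[OF a'(1)] a by (simp add: b_def Asub)
    have "\<phi> a - \<psi> a = \<phi> b - \<psi> b"
      using dense[OF a'(1)] a by (simp add: b_def add scale Asub)
    also have "cmod \<dots> \<le> norm b + norm b"
      by (rule order.trans[OF norm_triangle_ineq4]) (intro add_mono state_norm_le[OF A] \<phi> \<psi> id b)
    finally show ?thesis using nb by linarith
  qed
  then have "cmod (\<phi> a - \<psi> a) \<le> 0"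
    by (rule field_le_epsilon) simp
  then show "\<phi> a = \<psi> a" by simp
qed

section \<open>Metric axioms for the extended distance\<close>

lemma d_length_upper:
  "a \<in> reduced_group_cstar \<Longrightarrow> commutator_norm_le l a 1 \<Longrightarrow> ennreal (cmod (\<phi> a - \<psi> a)) \<le> d_length l \<phi> \<psi>"
  unfolding d_length_def by (intro SUP_upper) auto

lemma d_length_commute: "d_length l \<phi> \<psi> = d_length l \<psi> \<phi>"
  by (simp add: d_length_def norm_minus_commute)

lemma d_length_triangle: "d_length l \<phi> \<omega> \<le> d_length l \<phi> \<psi> + d_length l \<psi> \<omega>"
  unfolding d_length_def[of l \<phi> \<omega>]
proof (rule SUP_least)
  fix a assume "a \<in> {a \<in> reduced_group_cstar. commutator_norm_le l a 1}"
  then have a: "a \<in> reduced_group_cstar" "commutator_norm_le l a 1" by auto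
  have "ennreal (cmod (\<phi> a - \<omega> a)) \<le> ennreal (cmod (\<phi> a - \<psi> a) + cmod (\<psi> a - \<omega> a))"
    using norm_triangle_ineq[of "\<phi> a - \<psi> a" "\<psi> a - \<omega> a"] by (intro ennreal_leI) simp
  also have "\<dots> = ennreal (cmod (\<phi> a - \<psi> a)) + ennreal (cmod (\<psi> a - \<omega> a))"
    by (rule ennreal_plus) auto
  also have "\<dots> \<le> d_length l \<phi> \<psi> + d_length l \<psi> \<omega>"
    by (intro add_mono d_length_upper a)
  finally show "ennreal (cmod (\<phi> a - \<omega> a)) \<le> d_length l \<phi> \<psi> + d_length l \<psi> \<omega>" .
qed

text \<open>Suitably rescaled translations are admissible, so distance 0 forces agreement on every
  \<open>left_regular g\<close>, and this determines a state.\<close>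

lemma d_length_eq_0D:
  fixes X :: "'g::group_add set"
  assumes free: "free_generators X"
    and \<phi>: "\<phi> \<in> states reduced_group_cstar" and \<psi>: "\<psi> \<in> states reduced_group_cstar"
    and d: "d_length (word_length X) \<phi> \<psi> = 0"
  shows "\<phi> = \<psi>"
proof (rule states_eqI[OF \<phi> \<psi>])
  fix g
  let ?A = "reduced_group_cstar :: 'g ell2_op set"
  have A: "cstar_subalgebra ?A"
    by (simp add: reduced_group_cstar_eq cstar_subalgebra_closure_group_algebra)
  have gen: "scale_op c (left_regular g) \<in> ?A" for c
    using closure_subset group_algebra_gen[of c g] by (auto simp: reduced_group_cstar_eq)
  define r where "r = 1 / (real (word_length X g) + 1)"
  have "ennreal (cmod (\<phi> (scale_op (of_real r) (left_regular g)) - \<psi> (scale_op (of_real r) (left_regular g)))) \<le> 0"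
    unfolding d[symmetric] r_def
    by (intro d_length_upper gen commutator_left_regular word_length_add_diff free)
  then have "\<phi> (scale_op (of_real r) (left_regular g)) = \<psi> (scale_op (of_real r) (left_regular g))"
    by simp
  then have "of_real r * \<phi> (left_regular g) = of_real r * \<psi> (left_regular g)"
    using gen[of 1] by (simp add: state_scale_op[OF A \<phi>] state_scale_op[OF A \<psi>] id_in_reduced_group_cstar)
  moreover have "0 < r" by (simp add: r_def)
  ultimately show "\<phi> (left_regular g) = \<psi> (left_regular g)" by simp
qed

theorem theorem4p1:
  fixes X :: "'g::group_add set"
  assumes "finite X" and "card X \<ge> 2" and "free_generators X"
  defines "S \<equiv> states (reduced_group_cstar :: 'g ell2_op set)"
    and "d \<equiv> d_length (word_length X)"
  shows "(\<forall>\<phi>\<in>S. \<forall>\<psi>\<in>S. d \<phi> \<psi> < \<infinity>)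
    \<and> Metric_space S (\<lambda>\<phi> \<psi>. enn2real (d \<phi> \<psi>))
    \<and> Metric_space.mbounded S (\<lambda>\<phi> \<psi>. enn2real (d \<phi> \<psi>)) S
    \<and> (SUP \<phi>\<in>S. SUP \<psi>\<in>S. d \<phi> \<psi>) \<le> 5"
proof -
  have le: "d \<phi> \<psi> \<le> 5" if "\<phi> \<in> S" "\<psi> \<in> S" for \<phi> \<psi>
    unfolding d_def d_length_def
  proof (rule SUP_least)
    fix a assume "a \<in> {a \<in> reduced_group_cstar. commutator_norm_le (word_length X) a 1}"
    then have "ennreal (cmod (\<phi> a - \<psi> a)) \<le> ennreal 5"
      using that unfolding S_def by (intro ennreal_leI state_difference_le[OF assms(3)]) auto
    then show "ennreal (cmod (\<phi> a - \<psi> a)) \<le> 5" by simp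
  qed
  \<comment> \<open>\<open>enn2real\<close> sends \<open>top\<close> to 0, so finiteness is what
    lets separation and the triangle inequality pass to the real-valued distance.\<close>
  have fin: "d \<phi> \<psi> < top" if "\<phi> \<in> S" "\<psi> \<in> S" for \<phi> \<psi>
    using le[OF that] by (rule order.strict_trans1) simp
  interpret Metric_space S "\<lambda>\<phi> \<psi>. enn2real (d \<phi> \<psi>)"
  proof
    show "0 \<le> enn2real (d \<phi> \<psi>)" for \<phi> \<psi> by simp
    show "enn2real (d \<phi> \<psi>) = enn2real (d \<psi> \<phi>)" for \<phi> \<psi>
      by (simp add: d_def d_length_commute)
    show "enn2real (d \<phi> \<psi>) = 0 \<longleftrightarrow> \<phi> = \<psi>" if "\<phi> \<in> S" "\<psi> \<in> S" for \<phi> \<psi>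
    proof
      assume "enn2real (d \<phi> \<psi>) = 0"
      then have "d \<phi> \<psi> = 0" using fin[OF that] by (auto simp: enn2real_eq_0_iff)
      then show "\<phi> = \<psi>"
        using that d_length_eq_0D[OF assms(3)] by (simp add: S_def d_def)
    next
      assume "\<phi> = \<psi>"
      have "d \<psi> \<psi> \<le> 0"
        unfolding d_def d_length_def by (rule SUP_least) simp
      then show "enn2real (d \<phi> \<psi>) = 0" by (simp add: \<open>\<phi> = \<psi>\<close>)
    qed
    show "enn2real (d \<phi> \<omega>) \<le> enn2real (d \<phi> \<psi>) + enn2real (d \<psi> \<omega>)"
      if "\<phi> \<in> S" "\<psi> \<in> S" "\<omega> \<in> S" for \<phi> \<psi> \<omega>
    proof -
      have "enn2real (d \<phi> \<omega>) \<le> enn2real (d \<phi> \<psi> + d \<psi> \<omega>)"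
        using d_length_triangle fin that by (intro enn2real_mono) (auto simp: d_def)
      then show ?thesis
        using fin that by (simp add: enn2real_plus)
    qed
  qed
  have "mbounded S"
    unfolding mbounded_alt
  proof (intro conjI exI[of _ 5] ballI)
    show "enn2real (d \<phi> \<psi>) \<le> 5" if "\<phi> \<in> S" "\<psi> \<in> S" for \<phi> \<psi>
      using enn2real_mono[OF le[OF that]] by simp
  qed simp
  moreover have "(SUP \<phi>\<in>S. SUP \<psi>\<in>S. d \<phi> \<psi>) \<le> 5"
    by (intro SUP_least le)
  ultimately show ?thesis
    using fin Metric_space_axioms by simp
qed

end
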